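(* Let $n\ge 1$ and let $k_1,\ldots,k_n$ be non-negative integers. Let $u:\mathbb{D}^n\to\mathbb{C}$ be a nonzero analytic function and let $v:\mathbb{D}^n\to\mathbb{D}^n$, $v(z_1,\ldots,z_n)=(v_1(z_1),\ldots,v_n(z_n))$, be an analytic self-map of $\mathbb{D}^n$ such that $W_{u,v,k_1,\ldots,k_n}$ is bounded on $H^2(\mathbb{D}^n)$. Suppose $W_{u,v,k_1,\ldots,k_n}$ is $\mathcal{J}$-symmetric and $v_j(0)=0$ for all $j=1,\ldots,n$. Then $W_{u,v,k_1,\ldots,k_n}$ is normal.
   Context: $\mathbb{D}$ is the open unit disk in $\mathbb{C}$, $\mathbb{D}^n$ the polydisk, $\mathbb{T}^n$ the torus with normalized Haar measure $\sigma$. $H^2(\mathbb{D}^n)$ is the Hardy space of analytic $f:\mathbb{D}^n\to\mathbb{C}$ with $\|f\|^2=\sup_{0<r<1}\int_{\mathbb{T}^n}|f(r\zeta)|^2\,d\sigma(\zeta)<\infty$; it is a Hilbert space in which the monomials $\prod_i z_i^{m_i}$ ($m_i\ge 0$) form an orthonormal basis. In $v=(v_1,\ldots,v_n)$ each $v_j$ is an analytic self-map of $\mathbb{D}$ depending only on $z_j$. "Nonzero" means not identically zero. The weighted composition-differentiation operator is $W_{u,v,k_1,\ldots,k_n}f(z)=u(z)\,\frac{\partial^{m}f}{\partial z_1^{k_1}\cdots\partial z_n^{k_n}}(v(z))$ with $m=\sum_{i=1}^n k_i$. The standard conjugation on $H^2(\mathbb{D}^n)$ is $\mathcal{J}f(z)=\overline{f(\bar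 z)}$, where $\bar z=(\bar z_1,\ldots,\bar z_n)$. A bounded operator $T$ is $\mathcal{J}$-symmetric (complex symmetric with conjugation $\mathcal{J}$) if $T=\mathcal{J}T^*\mathcal{J}$, and normal if $T^*T=TT^*$. *)

theory Defs
  imports "HOL-Complex_Analysis.Complex_Analysis"
begin

definition polydisk :: "(complex^'n) set" where
  "polydisk = {z. \<forall>j. cmod (z $ j) < 1}"

text \<open>Holomorphy in several variables: complex Frechet differentiability at every point.
  The vector \<open>a\<close> is the complex gradient, so the derivative is required to be complex linear.\<close>

definition polydisk_analytic :: "(complex^'n \<Rightarrow> complex) \<Rightarrow> bool" where
  "polydisk_analytic f \<longleftrightarrow>
     (\<forall>z\<in>polydisk. \<exists>a::complex^'n. (f has_derivative (\<lambda>h. \<Sum>j\<in>UNIV. a $ j * h $ j)) (at z))"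

text \<open>The normalized Haar measure of the torus, regarded as a measure on the ambient space:
  the image of the product of the normalized Lebesgue measures on \<open>[0, 2\<pi>]\<close>
  under the coordinatewise map \<^const>\<open>cis\<close>.\<close>

definition torus_haar :: "(complex^'n) measure" where
  "torus_haar =
     distr (\<Pi>\<^sub>M j\<in>(UNIV :: 'n set). uniform_measure lborel {0..2*pi}) borel
       (\<lambda>\<theta>. \<chi> j. cis (\<theta> j))"

definition torus_mean :: "(complex^'n \<Rightarrow> complex) \<Rightarrow> real \<Rightarrow> real" where
  "torus_mean f r = (\<integral>\<zeta>. (cmod (f (r *\<^sub>R \<zeta>)))\<^sup>2 \<partial>torus_haar)"

text \<open>Functions on the polydisk are represented by total functions that vanish outside of it, so
  that equality of elements of the Hardy space is equality of functions.\<close>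

definition hardy_space :: "(complex^'n \<Rightarrow> complex) set" where
  "hardy_space = {f. polydisk_analytic f \<and> (\<forall>z. z \<notin> polydisk \<longrightarrow> f z = 0) \<and>
                     bdd_above (torus_mean f ` {0<..<1})}"

definition hardy_norm :: "(complex^'n \<Rightarrow> complex) \<Rightarrow> real" where
  "hardy_norm f = sqrt (SUP r\<in>{0<..<1}. torus_mean f r)"

text \<open>The inner product inducing \<^const>\<open>hardy_norm\<close>, recovered from it by polarization;
  linear in the first argument.\<close>

definition hardy_inner :: "(complex^'n \<Rightarrow> complex) \<Rightarrow> (complex^'n \<Rightarrow> complex) \<Rightarrow> complex" where
  "hardy_inner f g =
     Complex (((hardy_norm (\<lambda>z. f z + g z))\<^sup>2 - (hardy_norm (\<lambda>z. f z - g z))\<^sup>2) / 4)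
             (((hardy_norm (\<lambda>z. f z + \<i> * g z))\<^sup>2 - (hardy_norm (\<lambda>z. f z - \<i> * g z))\<^sup>2) / 4)"

type_synonym 'n operator = "(complex^'n \<Rightarrow> complex) \<Rightarrow> (complex^'n \<Rightarrow> complex)"

definition hardy_bounded :: "'n::finite operator \<Rightarrow> bool" where
  "hardy_bounded T \<longleftrightarrow>
     T \<in> hardy_space \<rightarrow> hardy_space \<and>
     (\<forall>f\<in>hardy_space. \<forall>g\<in>hardy_space. T (\<lambda>z. f z + g z) = (\<lambda>z. T f z + T g z)) \<and>
     (\<forall>f\<in>hardy_space. \<forall>c. T (\<lambda>z. c * f z) = (\<lambda>z. c * T f z)) \<and>
     (\<exists>C. \<forall>f\<in>hardy_space. hardy_norm (T f) \<le> C * hardy_norm f)"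

text \<open>\<open>S\<close> is the adjoint of \<open>T\<close>. The inner product being nondegenerate, \<open>S\<close> is determined on
  \<^const>\<open>hardy_space\<close> by \<open>T\<close>; for bounded \<open>T\<close> it exists by completeness.\<close>

definition is_hardy_adjoint :: "'n operator \<Rightarrow> 'n::finite operator \<Rightarrow> bool" where
  "is_hardy_adjoint T S \<longleftrightarrow>
     S \<in> hardy_space \<rightarrow> hardy_space \<and>
     (\<forall>f\<in>hardy_space. \<forall>g\<in>hardy_space. hardy_inner (T f) g = hardy_inner f (S g))"

definition hardy_conj :: "'n::finite operator" where
  "hardy_conj f = (\<lambda>z. cnj (f (\<chi> j. cnj (z $ j))))"

definition J_symmetric :: "'n::finite operator \<Rightarrow> bool" where
  "J_symmetric T \<longleftrightarrow> hardy_bounded T \<and>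
     (\<exists>S. is_hardy_adjoint T S \<and> (\<forall>f\<in>hardy_space. T f = hardy_conj (S (hardy_conj f))))"

definition hardy_normal :: "'n::finite operator \<Rightarrow> bool" where
  "hardy_normal T \<longleftrightarrow> hardy_bounded T \<and>
     (\<exists>S. is_hardy_adjoint T S \<and> (\<forall>f\<in>hardy_space. S (T f) = T (S f)))"

definition partial_deriv :: "'n \<Rightarrow> 'n::finite operator" where
  "partial_deriv j f = (\<lambda>z. deriv (\<lambda>w. f (\<chi> i. if i = j then w else z $ i)) (z $ j))"

text \<open>The index type carries no order, so the coordinates are differentiated in the order of some
  fixed enumeration; for analytic functions the order is irrelevant.\<close>

definition mixed_deriv :: "('n \<Rightarrow> nat) \<Rightarrow> 'n::finite operator" where
  "mixed_deriv k f =
     foldr (\<lambda>j. partial_deriv j ^^ k j) (SOME js. distinct js \<and> set js = UNIV) f"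

definition weighted_comp_diff ::
    "(complex^'n \<Rightarrow> complex) \<Rightarrow> ('n \<Rightarrow> complex \<Rightarrow> complex) \<Rightarrow> ('n \<Rightarrow> nat) \<Rightarrow> 'n::finite operator" where
  "weighted_comp_diff u v k f =
     (\<lambda>z. if z \<in> polydisk then u z * mixed_deriv k f (\<chi> j. v j (z $ j)) else 0)"

end

theory Submission
  imports Defs "HOL-Probability.Infinite_Product_Measure"
begin

text \<open>Expand every function in a power series on the polydisk and write \<open>W\<close> as a matrix in the monomial
  basis \<open>z\<^sup>a\<close>. Since \<open>J\<close> fixes the monomials, \<open>J\<close>-symmetry says that this matrix is symmetric.
  Row and column \<open>k\<close> of the symmetry, together with \<open>W z\<^sup>a = 0\<close> unless \<open>k \<le> a\<close>, force
  \<open>u = c z\<^sup>k\<close>: for \<open>b \<noteq> k\<close> the coefficient of \<open>z\<^sup>k\<close> in \<open>u v\<^bsup>b-k\<^esup>\<close> vanishes because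
  \<open>v\<^sub>j(0) = 0\<close>. Comparing the indices \<open>k + e\<^sub>j\<close> and \<open>k + m e\<^sub>j\<close> with \<open>m \<ge> 2\<close> then kills all Taylor
  coefficients of \<open>v\<^sub>j\<close> but the linear one, as \<open>v\<^sub>j\<^sup>m\<close> has no linear term. So \<open>W\<close> is diagonal in the
  monomial basis, and so is its adjoint; diagonal operators commute.\<close>

text \<open>\<open>hardy_norm\<close> is a supremum of means and \<open>hardy_inner\<close> merely
  its polarization, so the definitions do not hand over sesquilinearity. The proof works with inner
  products against monomials: Parseval at each radius shows how the norm changes when
  \<open>c z^b\<close> is added, and polarization then returns the \<open>b\<close>-th Taylor
  coefficient. Parseval rests on power series for functions that are only known to be Frechet
  differentiable; these come from the iterated Cauchy formula, whose kernel is a product of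
  geometric series. Series over multi-indices are unordered sums (\<open>has_sum\<close>), so no
  enumeration of multi-indices is chosen and convergence is absolute.

  That \<open>W\<close> is diagonal is seen on the power series of every \<open>f\<close>, where
  differentiation, composition and multiplication by \<open>c z^k\<close> act term by term. The
  eigenvalue at \<open>z^a\<close> is \<open>c a!/(a-k)! \<alpha>^(a-k)\<close> if
  \<open>k \<le> a\<close>, and \<open>0\<close> otherwise. By symmetry the adjoint is
  \<open>J W J\<close>, so it multiplies coefficients by the conjugate eigenvalues.\<close>

no_notation fps_nth (infixl "$" 75)

section \<open>Circle means and termwise integration\<close>

definition angle_measure :: "real measure" where
  "angle_measure = uniform_measure lborel {0..2*pi}"

lemma prob_space_angle_measure: "prob_space angle_measure"
  unfolding angle_measure_def by (rule prob_space_uniform_measure) auto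

interpretation angle: prob_space angle_measure
  by (rule prob_space_angle_measure)

lemma sets_angle_measure [measurable_cong, simp]: "sets angle_measure = sets borel"
  by (simp add: angle_measure_def)

lemma integral_angle_measure:
  fixes g :: "real \<Rightarrow> complex"
  assumes "continuous_on UNIV g"
  shows "integral\<^sup>L angle_measure g = integral {0..2*pi} g / (2*pi)"
proof -
  have [measurable]: "g \<in> borel_measurable borel"
    using assms by (rule borel_measurable_continuous_onI)
  have eq: "angle_measure = density lborel (\<lambda>x. ennreal (indicator {0..2*pi} x / (2*pi)))"
    unfolding angle_measure_def uniform_measure_def
    by (intro density_cong) (auto split: split_indicator simp: divide_ennreal[symmetric])
  have "integral\<^sup>L angle_measure g = (\<integral>x. (indicator {0..2*pi} x / (2*pi)) *\<^sub>R g x \<partial>lborel)"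
    unfolding eq by (rule integral_density) simp_all
  also have "\<dots> = (\<integral>x. (indicator {0..2*pi} x *\<^sub>R g x) / (2*pi) \<partial>lborel)"
    by (intro Bochner_Integration.integral_cong) (auto simp: scaleR_conv_of_real field_simps)
  also have "\<dots> = (LINT x:{0..2*pi}|lborel. g x) / (2*pi)"
    by (simp add: set_lebesgue_integral_def)
  also have "(LINT x:{0..2*pi}|lborel. g x) = integral {0..2*pi} g"
    by (intro set_borel_integral_eq_integral borel_integrable_atLeastAtMost'
        continuous_on_subset[OF assms]) auto
  finally show ?thesis .
qed

lemma integrable_angle_measure:
  fixes g :: "real \<Rightarrow> complex"
  assumes "continuous_on UNIV g" "\<And>x. norm (g x) \<le> B"
  shows "integrable angle_measure g"
proof (rule angle.integrable_const_bound)
  show "g \<in> borel_measurable angle_measure"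
    using borel_measurable_continuous_onI[OF assms(1)] by measurable
qed (use assms in auto)

text \<open>On the circle \<open>w = r e^(i\<theta>)\<close> one has
  \<open>dw = i w d\<theta>\<close>, so \<open>dw / (2 pi i (w - z))\<close> becomes the kernel
  \<open>1 / (1 - z e^(-i\<theta>) / r)\<close> against the normalized measure. This form is the sum
  of a geometric series in \<open>z\<close>.\<close>

lemma Cauchy_angle_measure:
  assumes f: "f holomorphic_on ball 0 1" and r: "r < 1" "cmod z < r"
  shows "(\<integral>\<theta>. f (r * cis \<theta>) / (1 - z * cis (-\<theta>) / r) \<partial>angle_measure) = f z"
proof -
  have r0: "r > 0" using r(2) norm_ge_zero[of z] by linarith
  have ne: "r * cis \<theta> \<noteq> z" for \<theta>
    using r(2) r0 by (metis abs_of_pos less_irrefl mult.right_neutral norm_cis norm_mult norm_of_real)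
  have sub: "cball 0 r \<subseteq> ball (0::complex) 1" using r by auto
  have conv: "f (r * cis \<theta>) / (1 - z * cis (-\<theta>) / r) = f (r * cis \<theta>) / (r * cis \<theta> - z) * r * cis \<theta>" for \<theta>
  proof -
    have "1 - z * cis (-\<theta>) / r = (r * cis \<theta> - z) / (r * cis \<theta>)"
      using r0 by (simp add: field_simps flip: cis_inverse)
    then show ?thesis by simp
  qed
  have "((\<lambda>u. f u / (u - z)) has_contour_integral (2 * of_real pi * \<i> * f z)) (circlepath 0 r)"
    using f sub r by (intro Cauchy_integral_circlepath)
      (auto intro: holomorphic_on_imp_continuous_on holomorphic_on_subset continuous_on_subset)
  then have "((\<lambda>t. f (r * cis t) / (r * cis t - z) * r * \<i> * cis t) has_integral
      (2 * of_real pi * \<i> * f z)) {0..2*pi}"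
    by (simp add: circlepath_def has_contour_integral_part_circlepath_iff)
  from has_integral_mult_right[OF this, of "-\<i>"]
  have I: "((\<lambda>t. f (r * cis t) / (r * cis t - z) * r * cis t) has_integral (2 * of_real pi * f z)) {0..2*pi}"
    by (simp add: algebra_simps)
  have cont: "continuous_on UNIV (\<lambda>t. f (r * cis t) / (r * cis t - z) * r * cis t)"
    using ne r r0
    by (intro continuous_intros continuous_on_compose2[OF holomorphic_on_imp_continuous_on[OF f]])
      (auto simp: norm_mult)
  show ?thesis
    unfolding conv integral_angle_measure[OF cont] integral_unique[OF I] by simp
qed

text \<open>Orthonormality of the characters: for \<open>a \<noteq> b\<close> the integrand is
  \<open>e^(im\<theta>)\<close> with \<open>m = a - b\<close>, a nonzero and possibly negative
  integer, and its antiderivative is periodic.\<close>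

lemma integral_cis_angle_measure:
  "(\<integral>\<theta>. cis \<theta> ^ a * cnj (cis \<theta> ^ b) \<partial>angle_measure) = (if a = b then 1 else 0)"
proof (cases "a = b")
  case True
  have "cis \<theta> * cnj (cis \<theta>) = 1" for \<theta>
    by (metis complex_norm_square norm_cis of_real_1 power_one)
  then have "cis \<theta> ^ b * cnj (cis \<theta> ^ b) = 1" for \<theta>
    by (metis complex_cnj_power power_mult_distrib power_one)
  then show ?thesis using True by (simp add: angle.prob_space)
next
  case False
  define m where "m = real a - real b"
  have m: "m \<noteq> 0" using False by (simp add: m_def)
  have eq: "cis \<theta> ^ a * cnj (cis \<theta> ^ b) = cis (m * \<theta>)" for \<theta>
    by (simp add: Complex.DeMoivre cis_cnj cis_mult m_def algebra_simps)
  have "((\<lambda>\<theta>. cis (m * \<theta>)) has_integral (cis (m * (2*pi)) / (\<i> * m) - cis (m * 0) / (\<i> * m))) {0..2*pi}"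
  proof (rule fundamental_theorem_of_calculus)
    fix x :: real
    have "((\<lambda>w. exp (\<i> * m * w) / (\<i> * m)) has_field_derivative exp (\<i> * m * of_real x)) (at (of_real x) within S)" for S
      using m by (auto intro!: derivative_eq_intros)
    from has_vector_derivative_real_field[OF this]
    show "((\<lambda>\<theta>. cis (m * \<theta>) / (\<i> * m)) has_vector_derivative cis (m * x)) (at x within {0..2*pi})"
      by (simp add: cis_conv_exp mult_ac)
  qed simp
  moreover have "cis (m * (2*pi)) = 1"
  proof -
    have "cis (real_of_int (int a - int b) * (2*pi)) = 1"
      using cis_multiple_2pi[of "int a - int b"] by (metis Ints_of_int cis_multiple_2pi mult.commute)
    then show ?thesis by (simp add: m_def)
  qed
  ultimately have "integral {0..2*pi} (\<lambda>\<theta>. cis (m * \<theta>)) = 0"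
    by (simp add: integral_unique)
  then show ?thesis unfolding eq using False
    by (simp add: integral_angle_measure continuous_intros)
qed

text \<open>Termwise integration under a summable bound uniform in \<open>x\<close>. The classical
  result concerns series over \<open>nat\<close>, so the countable index type is embedded by
  \<open>to_nat\<close> and the gaps are filled with zeros; absolute convergence then turns the
  series back into an unordered sum.\<close>

lemma (in prob_space) has_sum_integral:
  fixes g :: "'i::countable \<Rightarrow> 'a \<Rightarrow> complex"
  assumes meas [measurable]: "\<And>i. g i \<in> borel_measurable M"
    and bd: "\<And>i x. x \<in> space M \<Longrightarrow> norm (g i x) \<le> B i" and B: "B summable_on UNIV"
    and sum: "\<And>x. x \<in> space M \<Longrightarrow> ((\<lambda>i. g i x) has_sum G x) UNIV"
  shows "G \<in> borel_measurable M" "((\<lambda>i. \<integral>x. g i x \<partial>M) has_sum (\<integral>x. G x \<partial>M)) UNIV"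
proof -
  let ?R = "range (to_nat :: 'i \<Rightarrow> nat)"
  have trans: "((\<lambda>n. if n \<in> ?R then h (from_nat n) else 0) has_sum s) UNIV \<longleftrightarrow> (h has_sum s) UNIV"
    for h :: "'i \<Rightarrow> 'b::{comm_monoid_add,topological_space}" and s
  proof -
    have "((\<lambda>n. if n \<in> ?R then h (from_nat n) else 0) has_sum s) UNIV \<longleftrightarrow>
        ((\<lambda>n. h (from_nat n)) has_sum s) ?R"
      by (rule has_sum_cong_neutral) auto
    also have "\<dots> \<longleftrightarrow> (h has_sum s) UNIV"
      by (subst has_sum_reindex) (auto simp: o_def)
    finally show ?thesis .
  qed
  define g' where "g' n x = (if n \<in> ?R then g (from_nat n) x else 0)" for n x
  define B' where "B' n = (if n \<in> ?R then B (from_nat n) else 0)" for n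
  have g'm [measurable]: "g' n \<in> borel_measurable M" for n
    unfolding g'_def by auto
  obtain x0 where "x0 \<in> space M" using not_empty by auto
  then have B0: "0 \<le> B i" for i by (rule order_trans[OF norm_ge_zero bd])
  have B'0: "0 \<le> B' n" for n by (auto simp: B'_def B0)
  have B': "summable B'"
  proof -
    from B obtain s where "(B has_sum s) UNIV" by (auto simp: summable_on_def)
    then have "(B' has_sum s) UNIV" unfolding B'_def by (subst trans)
    then show ?thesis by (rule sums_summable[OF has_sum_imp_sums])
  qed
  have bd': "norm (g' n x) \<le> B' n" if "x \<in> space M" for n x
    using bd[OF that] by (auto simp: g'_def B'_def)
  have sum': "(\<lambda>n. g' n x) sums G x" if "x \<in> space M" for x
    unfolding g'_def by (intro has_sum_imp_sums) (subst trans, rule sum[OF that])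
  show "G \<in> borel_measurable M"
  proof (subst measurable_cong)
    show "G x = (\<Sum>n. g' n x)" if "x \<in> space M" for x
      using sum'[OF that] by (simp add: sums_iff)
  qed measurable
  have int': "integrable M (g' n)" for n
    by (rule integrable_const_bound[where B = "B' n"]) (auto simp: bd' intro!: AE_I2)
  have ns: "norm (\<integral>x. norm (g' n x) \<partial>M) \<le> B' n" for n
  proof -
    have "(\<integral>x. norm (g' n x) \<partial>M) \<le> (\<integral>x. B' n \<partial>M)"
      by (intro integral_mono integrable_norm int') (auto simp: bd')
    then show ?thesis by (simp add: prob_space)
  qed
  have "(\<lambda>n. \<integral>x. g' n x \<partial>M) sums (\<integral>x. (\<Sum>n. g' n x) \<partial>M)"
    by (intro sums_integral int' AE_I2 summable_comparison_test'[OF B', of 0]) (use ns bd' in auto)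
  also have "(\<integral>x. (\<Sum>n. g' n x) \<partial>M) = (\<integral>x. G x \<partial>M)"
    by (intro Bochner_Integration.integral_cong) (use sum' in \<open>auto simp: sums_iff\<close>)
  finally have s: "(\<lambda>n. \<integral>x. g' n x \<partial>M) sums (\<integral>x. G x \<partial>M)" .
  have "summable (\<lambda>n. norm (\<integral>x. g' n x \<partial>M))"
  proof (rule summable_comparison_test'[OF B', of 0])
    show "norm (norm (\<integral>x. g' n x \<partial>M)) \<le> B' n" for n
      using order_trans[OF integral_norm_bound[of M "g' n"], of "B' n"] ns[of n] by simp
  qed
  then have "((\<lambda>n. \<integral>x. g' n x \<partial>M) has_sum (\<integral>x. G x \<partial>M)) UNIV"
    using s by (rule norm_summable_imp_has_sum)
  also have "(\<lambda>n. \<integral>x. g' n x \<partial>M) = (\<lambda>n. if n \<in> ?R then \<integral>x. g (from_nat n) x \<partial>M else 0)"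
    by (auto simp: g'_def fun_eq_iff)
  finally show "((\<lambda>i. \<integral>x. g i x \<partial>M) has_sum (\<integral>x. G x \<partial>M)) UNIV"
    by (subst (asm) trans)
qed

text \<open>Over the complex numbers an unordered sum converges absolutely, so the finite product of
  series may be multiplied out. Two notions of absolute summability meet here;
  \<open>abs_summable_equivalent\<close> passes between them.\<close>

lemma has_sum_prod_fun:
  fixes f :: "'n::finite \<Rightarrow> nat \<Rightarrow> complex"
  assumes "\<And>j. (f j has_sum s j) UNIV"
  shows "((\<lambda>a. \<Prod>j\<in>UNIV. f j (a j)) has_sum (\<Prod>j\<in>UNIV. s j)) UNIV"
proof -
  have abs: "Infinite_Sum.abs_summable_on (f j) UNIV" for j
    using has_sum_imp_summable[OF assms[of j]] by (rule summable_on_iff_abs_summable_on_complex[THEN iffD1])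
  have U: "PiE UNIV (\<lambda>_::'n. UNIV::nat set) = UNIV" by auto
  have "Infinite_Set_Sum.abs_summable_on (\<lambda>a. \<Prod>j\<in>UNIV. f j (a j)) (PiE UNIV (\<lambda>_. UNIV))"
    by (rule abs_summable_on_prod_PiE) (auto intro: abs_summable_equivalent[THEN iffD1] abs)
  then have "(\<lambda>a. \<Prod>j\<in>UNIV. f j (a j)) summable_on PiE UNIV (\<lambda>_. UNIV)"
    by (rule abs_summable_summable[OF abs_summable_equivalent[THEN iffD2]])
  moreover have "infsum (\<lambda>a. \<Prod>j\<in>UNIV. f j (a j)) (PiE UNIV (\<lambda>_. UNIV)) = (\<Prod>j\<in>UNIV. infsum (f j) UNIV)"
    by (rule infsum_prod_PiE_abs[OF finite abs])
  moreover have "infsum (f j) UNIV = s j" for j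
    by (rule infsumI[OF assms])
  ultimately show ?thesis unfolding U by (simp add: has_sum_iff)
qed

section \<open>Power series on the polydisk\<close>

text \<open>The measure behind \<open>torus_haar\<close>, kept in angle coordinates so that Fubini
  can split off one coordinate at a time.\<close>

definition angles :: "('n::finite \<Rightarrow> real) measure" where
  "angles = (\<Pi>\<^sub>M j\<in>UNIV. angle_measure)"

definition torus_point :: "('n::finite \<Rightarrow> real) \<Rightarrow> complex^'n" where
  "torus_point \<theta> = (\<chi> j. cis (\<theta> j))"

definition monomial :: "('n::finite \<Rightarrow> nat) \<Rightarrow> complex^'n \<Rightarrow> complex" where
  "monomial a z = (\<Prod>j\<in>UNIV. z $ j ^ a j)"

definition total_degree :: "('n::finite \<Rightarrow> nat) \<Rightarrow> nat" where
  "total_degree a = (\<Sum>j\<in>UNIV. a j)"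

text \<open>An unordered sum over all multi-indices, hence absolute convergence. The radius is a
  parameter because the Cauchy formula first yields the expansion on smaller polydisks.\<close>

definition power_series_on :: "real \<Rightarrow> (('n::finite \<Rightarrow> nat) \<Rightarrow> complex) \<Rightarrow> (complex^'n \<Rightarrow> complex) \<Rightarrow> bool" where
  "power_series_on R A f \<longleftrightarrow>
     (\<forall>z. (\<forall>j. cmod (z $ j) < R) \<longrightarrow> ((\<lambda>a. A a * monomial a z) has_sum f z) UNIV)"

text \<open>Taken at an inner radius \<open>r\<close>, since the functions in question are given
  only inside the polydisk. For a power series it carries an extra factor
  \<open>r^|a|\<close>.\<close>

definition fourier_coeff :: "(complex^'n::finite \<Rightarrow> complex) \<Rightarrow> real \<Rightarrow> ('n \<Rightarrow> nat) \<Rightarrow> complex" where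
  "fourier_coeff f r a = (\<integral>\<theta>. f (r *\<^sub>R torus_point \<theta>) * cnj (monomial a (torus_point \<theta>)) \<partial>angles)"

interpretation angle_prod: product_sigma_finite "\<lambda>_. angle_measure"
  by unfold_locales

interpretation angles: prob_space "angles :: ('n::finite \<Rightarrow> real) measure"
  unfolding angles_def by (intro prob_space_PiM prob_space_angle_measure)

lemma space_angle_measure [simp]: "space angle_measure = UNIV"
  by (simp add: angle_measure_def)

lemma space_angles [simp]: "space (angles :: ('n::finite \<Rightarrow> real) measure) = UNIV"
  by (simp add: angles_def space_PiM)

lemma measurable_vec_lambda:
  assumes "\<And>i. (\<lambda>x. f x i) \<in> borel_measurable M"
  shows "(\<lambda>x. (\<chi> i. f x i) :: complex^'n::finite) \<in> M \<rightarrow>\<^sub>M borel"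
proof (subst borel_measurable_euclidean_space, intro ballI)
  fix b :: "complex^'n" assume "b \<in> Basis"
  then obtain i c where b: "b = axis i c" by (auto simp: Basis_vec_def)
  show "(\<lambda>x. (\<chi> i. f x i) \<bullet> b) \<in> borel_measurable M"
    using assms[of i] by (simp add: b inner_axis)
qed

lemma measurable_torus_point [measurable]: "torus_point \<in> angles \<rightarrow>\<^sub>M borel"
proof -
  have [measurable]: "cis \<in> borel_measurable borel"
    by (intro borel_measurable_continuous_onI continuous_intros)
  show ?thesis
    unfolding torus_point_def angles_def by (intro measurable_vec_lambda) measurable
qed

lemma borel_measurable_monomial [measurable]: "monomial a \<in> borel_measurable borel"
  unfolding monomial_def by (intro borel_measurable_continuous_onI continuous_intros)

lemma borel_measurable_cnj [measurable (raw)]: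
  "f \<in> borel_measurable M \<Longrightarrow> (\<lambda>x. cnj (f x)) \<in> borel_measurable M"
  by (rule borel_measurable_continuous_on[OF continuous_on_cnj[OF continuous_on_id]])

lemma norm_torus_point_nth [simp]: "cmod (torus_point \<theta> $ j) = 1"
  by (simp add: torus_point_def)

lemma norm_monomial_torus_point [simp]: "cmod (monomial a (torus_point \<theta>)) = 1"
  by (simp add: monomial_def prod_norm[symmetric] norm_power)

lemma monomial_scaleR: "monomial a (r *\<^sub>R z) = of_real (r ^ total_degree a) * monomial a z"
proof -
  have "(r *\<^sub>R z) $ j = of_real r * z $ j" for j
    by (simp only: vector_scaleR_component) (simp add: scaleR_conv_of_real)
  then show ?thesis
    by (simp add: monomial_def total_degree_def power_mult_distrib prod.distrib power_sum)
qed

section \<open>Topology of the polydisk, slices, and the Cauchy formula\<close>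

lemma open_polydisk: "open (polydisk :: (complex^'n::finite) set)"
proof -
  have "polydisk = (\<Inter>j\<in>UNIV. {z::complex^'n. cmod (z $ j) < 1})"
    by (auto simp: polydisk_def)
  moreover have "open {z::complex^'n. cmod (z $ j) < 1}" for j
    by (intro open_Collect_less continuous_intros)
  ultimately show ?thesis by (metis finite open_INT)
qed

lemma compact_closed_polydisk: "compact {z::complex^'n::finite. \<forall>j. cmod (z $ j) \<le> r}"
proof -
  have "closed {z::complex^'n. \<forall>j. cmod (z $ j) \<le> r}"
    by (intro closed_Collect_all closed_Collect_le continuous_intros)
  moreover have "bounded {z::complex^'n. \<forall>j. cmod (z $ j) \<le> r}"
    unfolding bounded_iff
  proof (intro exI ballI)
    fix z :: "complex^'n" assume z: "z \<in> {z. \<forall>j. cmod (z $ j) \<le> r}"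
    have "norm z \<le> (\<Sum>j\<in>UNIV. cmod (z $ j))"
      unfolding norm_vec_def by (rule L2_set_le_sum) auto
    also have "\<dots> \<le> (\<Sum>j\<in>(UNIV::'n set). r)" using z by (intro sum_mono) auto
    finally show "norm z \<le> (\<Sum>j\<in>(UNIV::'n set). r)" .
  qed
  ultimately show ?thesis by (simp add: compact_eq_bounded_closed)
qed

lemma polydisk_analytic_continuous_on: "polydisk_analytic f \<Longrightarrow> continuous_on polydisk f"
  unfolding polydisk_analytic_def
  by (meson continuous_at_imp_continuous_on has_derivative_continuous)

text \<open>Chain rule along the affine line \<open>w \<mapsto> L 0 + axis j w\<close>: only the
  \<open>j\<close>-th entry of the complex gradient survives, and it is the derivative of the
  slice.\<close>

lemma polydisk_analytic_slice:
  fixes f :: "complex^'n::finite \<Rightarrow> complex"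
  assumes f: "polydisk_analytic f" and z: "\<And>i. i \<noteq> j \<Longrightarrow> cmod (z $ i) < 1"
  shows "(\<lambda>w. f (\<chi> i. if i = j then w else z $ i)) holomorphic_on ball 0 1"
proof (rule holomorphic_onI)
  fix w :: complex assume w: "w \<in> ball 0 1"
  define L where "L = (\<lambda>w. \<chi> i. if i = j then w else z $ i)"
  have "L w \<in> polydisk" using w z by (auto simp: L_def polydisk_def)
  then obtain a where a: "(f has_derivative (\<lambda>h. \<Sum>i\<in>UNIV. a $ i * h $ i)) (at (L w))"
    using f by (auto simp: polydisk_analytic_def)
  have lin: "bounded_linear (axis j :: complex \<Rightarrow> complex^'n)"
    by (auto intro!: linearI simp: linear_conv_bounded_linear[symmetric] axis_def vec_eq_iff)
  have "L = (\<lambda>w. L 0 + axis j w)"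
    by (auto simp: L_def fun_eq_iff vec_eq_iff axis_def)
  moreover have "((\<lambda>w. L 0 + axis j w) has_derivative axis j) (at w)"
    using bounded_linear_imp_has_derivative[OF lin] by (auto intro!: derivative_eq_intros)
  ultimately have "(L has_derivative axis j) (at w)" by simp
  from diff_chain_at[OF this a]
  have "(f \<circ> L has_derivative (\<lambda>h. a $ j * h)) (at w)"
    by (simp add: o_def axis_def if_distrib cong: if_cong)
  then have "(f \<circ> L has_field_derivative a $ j) (at w)"
    by (simp add: has_field_derivative_def)
  then have "(f \<circ> L has_field_derivative a $ j) (at w within ball 0 1)"
    by (rule has_field_derivative_at_within)
  then show "(\<lambda>w. f (\<chi> i. if i = j then w else z $ i)) field_differentiable at w within ball 0 1"
    by (auto simp: field_differentiable_def o_def L_def)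
qed

text \<open>Off the polydisk \<open>f\<close> is arbitrary, so it is first cut off by the indicator
  of this open set; along \<open>g\<close> the cut-off changes nothing.\<close>

lemma borel_measurable_polydisk_comp:
  fixes f :: "complex^'n::finite \<Rightarrow> complex"
  assumes f: "continuous_on polydisk f" and g [measurable]: "g \<in> M \<rightarrow>\<^sub>M borel"
    and gd: "\<And>x. x \<in> space M \<Longrightarrow> g x \<in> polydisk"
  shows "(\<lambda>x. f (g x)) \<in> borel_measurable M"
proof -
  have [measurable]: "(\<lambda>z. indicator polydisk z *\<^sub>R f z) \<in> borel_measurable borel"
    by (intro borel_measurable_continuous_on_indicator borel_open open_polydisk f)
  have "(\<lambda>x. indicator polydisk (g x) *\<^sub>R f (g x)) \<in> borel_measurable M" 
    using measurable_compose[OF g, of "\<lambda>z. indicator polydisk z *\<^sub>R f z" borel] by simp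
  then show ?thesis by (rule measurable_cong[THEN iffD1, rotated]) (simp add: gd)
qed

lemma continuous_on_polydisk_bounded:
  fixes f :: "complex^'n::finite \<Rightarrow> complex"
  assumes "continuous_on polydisk f" "r < 1"
  obtains B where "B \<ge> 0" "\<And>z. (\<And>j. cmod (z $ j) \<le> r) \<Longrightarrow> cmod (f z) \<le> B"
proof -
  let ?K = "{z::complex^'n. \<forall>j. cmod (z $ j) \<le> r}"
  have "?K \<subseteq> polydisk" using assms(2) by (auto simp: polydisk_def intro: le_less_trans)
  then have "compact (f ` ?K)"
    using assms compact_closed_polydisk
    by (intro compact_continuous_image continuous_on_subset[OF assms(1)])
  then obtain B where "B > 0" "\<forall>x\<in>f ` ?K. norm x \<le> B"
    using compact_imp_bounded bounded_pos by blast
  then show ?thesis using that[of B] by auto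
qed

text \<open>Induction on the set \<open>J\<close> of coordinates already moved to the circle of
  radius \<open>r\<close>. Fubini isolates the new coordinate, where the one-variable formula for
  the slice puts \<open>z $ j\<close> back.\<close>

lemma polydisk_Cauchy_integral:
  fixes f :: "complex^'n::finite \<Rightarrow> complex"
  assumes f: "polydisk_analytic f" and r: "r < 1" and "finite J" and z: "\<And>j. cmod (z $ j) < r"
  shows "(\<integral>\<theta>. f (\<chi> i. if i \<in> J then r * cis (\<theta> i) else z $ i) *
            (\<Prod>i\<in>J. 1 / (1 - z $ i * cis (- \<theta> i) / r)) \<partial>(\<Pi>\<^sub>M i\<in>J. angle_measure)) = f z"
  using \<open>finite J\<close>
proof (induction J rule: finite_induct)
  case empty
  interpret E: prob_space "\<Pi>\<^sub>M i\<in>({}::'n set). angle_measure"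
    by (intro prob_space_PiM prob_space_angle_measure)
  show ?case by (simp add: E.prob_space)
next
  case (insert j J)
  have r0: "r > 0" using z[of undefined] norm_ge_zero[of "z $ undefined"] by linarith
  have z1: "cmod (z $ i) < 1" for i using z[of i] r by linarith
  let ?P = "\<lambda>J \<theta>. \<chi> i. if i \<in> J then r * cis (\<theta> i) else z $ i"
  let ?K = "\<lambda>i t. 1 / (1 - z $ i * cis (- t) / r)"
  let ?F = "\<lambda>\<theta>. f (?P (insert j J) \<theta>) * (\<Prod>i\<in>insert j J. ?K i (\<theta> i))"
  interpret I: prob_space "\<Pi>\<^sub>M i\<in>insert j J. angle_measure"
    by (intro prob_space_PiM prob_space_angle_measure)
  have [measurable]: "cis \<in> borel_measurable borel"
    by (intro borel_measurable_continuous_onI continuous_intros)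
  have cont: "continuous_on polydisk f" by (rule polydisk_analytic_continuous_on[OF f])
  have "integrable (\<Pi>\<^sub>M i\<in>insert j J. angle_measure) ?F"
  proof -
    have "(\<lambda>\<theta>. if i \<in> insert j J then r * cis (\<theta> i) else z $ i) \<in>
        borel_measurable (\<Pi>\<^sub>M i\<in>insert j J. angle_measure)" for i
    proof (cases "i \<in> insert j J")
      case True
      then show ?thesis by (simp del: insert_iff) measurable
    next
      case False
      then show ?thesis by (simp del: insert_iff)
    qed
    then have m1: "(\<lambda>\<theta>. f (?P (insert j J) \<theta>)) \<in> borel_measurable (\<Pi>\<^sub>M i\<in>insert j J. angle_measure)"
      using r r0 z1
      by (intro borel_measurable_polydisk_comp[OF cont] measurable_vec_lambda)
        (auto simp: polydisk_def norm_mult)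
    have m2: "(\<lambda>\<theta>. \<Prod>i\<in>insert j J. ?K i (\<theta> i)) \<in> borel_measurable (\<Pi>\<^sub>M i\<in>insert j J. angle_measure)"
      by measurable
    obtain B where B: "B \<ge> 0" "\<And>z. (\<And>j. cmod (z $ j) \<le> r) \<Longrightarrow> cmod (f z) \<le> B"
      using continuous_on_polydisk_bounded[OF cont r] by metis
    have b1: "cmod (f (?P (insert j J) \<theta>)) \<le> B" for \<theta>
      using r0 z by (intro B(2)) (auto simp: norm_mult less_imp_le)
    \<comment> \<open>The denominator stays away from zero uniformly in \<open>t\<close>, as its
      modulus is at least \<open>1 - |z_i| / r > 0\<close>.\<close>
    have Kb: "cmod (?K i t) \<le> 1 / (1 - cmod (z $ i) / r)" for i t
    proof -
      have "1 - cmod (z $ i) / r \<le> cmod (1 - z $ i * cis (- t) / r)"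
        using norm_triangle_ineq2[of 1 "z $ i * cis (- t) / r"] r0
        by (simp add: norm_mult norm_divide)
      moreover have "0 < 1 - cmod (z $ i) / r" using z r0 by simp
      ultimately show ?thesis by (simp add: norm_divide frac_le)
    qed
    have b2: "cmod (\<Prod>i\<in>insert j J. ?K i (\<theta> i)) \<le> (\<Prod>i\<in>insert j J. 1 / (1 - cmod (z $ i) / r))" for \<theta>
      unfolding prod_norm[symmetric] using Kb by (intro prod_mono) auto
    show ?thesis
    proof (rule I.integrable_const_bound[where B = "B * (\<Prod>i\<in>insert j J. 1 / (1 - cmod (z $ i) / r))"])
      show "AE \<theta> in \<Pi>\<^sub>M i\<in>insert j J. angle_measure.
          norm (?F \<theta>) \<le> B * (\<Prod>i\<in>insert j J. 1 / (1 - cmod (z $ i) / r))"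
        unfolding norm_mult by (intro AE_I2 mult_mono b1 b2 B norm_ge_zero)
    qed (intro borel_measurable_times m1 m2)
  qed
  then have "integral\<^sup>L (\<Pi>\<^sub>M i\<in>insert j J. angle_measure) ?F =
      (\<integral>x. (\<integral>y. ?F (x(j := y)) \<partial>angle_measure) \<partial>(\<Pi>\<^sub>M i\<in>J. angle_measure))"
    by (rule angle_prod.product_integral_insert[OF insert(1,2)])
  also have "\<dots> = (\<integral>x. f (?P J x) * (\<Prod>i\<in>J. ?K i (x i)) \<partial>(\<Pi>\<^sub>M i\<in>J. angle_measure))"
  proof (rule Bochner_Integration.integral_cong[OF refl])
    fix x :: "'n \<Rightarrow> real"
    \<comment> \<open>Since \<open>j\<close> is not in \<open>J\<close>, the \<open>j\<close>-th
      entry of \<open>?P J x\<close> is still \<open>z $ j\<close>; evaluating the slice there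
      returns \<open>f (?P J x)\<close>.\<close>
    let ?g = "\<lambda>w. f (\<chi> i. if i = j then w else ?P J x $ i)"
    have pr: "(\<Prod>i\<in>J. ?K i ((x(j := y)) i)) = (\<Prod>i\<in>J. ?K i (x i))" for y
      using insert(2) by (intro prod.cong) auto
    have "?P (insert j J) (x(j := y)) = (\<chi> i. if i = j then r * cis y else ?P J x $ i)" for y
      by (auto simp: vec_eq_iff)
    then have "?F (x(j := y)) = (?g (r * cis y) / (1 - z $ j * cis (- y) / r)) * (\<Prod>i\<in>J. ?K i (x i))" for y
      using insert(1,2) pr[of y] by (simp add: prod.insert)
    then have "(\<integral>y. ?F (x(j := y)) \<partial>angle_measure) =
        (\<integral>y. ?g (r * cis y) / (1 - z $ j * cis (- y) / r) \<partial>angle_measure) * (\<Prod>i\<in>J. ?K i (x i))"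
      by (simp only: Bochner_Integration.integral_mult_left_zero)
    also have "(\<integral>y. ?g (r * cis y) / (1 - z $ j * cis (- y) / r) \<partial>angle_measure) = ?g (z $ j)"
      using r r0 z1 z
      by (intro Cauchy_angle_measure polydisk_analytic_slice f) (auto simp: norm_mult)
    also have "(\<chi> i. if i = j then z $ j else ?P J x $ i) = ?P J x"
      using insert(2) by (auto simp: vec_eq_iff)
    finally show "(\<integral>y. ?F (x(j := y)) \<partial>angle_measure) = f (?P J x) * (\<Prod>i\<in>J. ?K i (x i))" .
  qed
  also have "\<dots> = f z" by (rule insert.IH)
  finally show ?case .
qed

section \<open>Fourier coefficients, uniqueness and existence of power series\<close>

lemma has_sum_delta: "((\<lambda>a. if a = b then f a else 0) has_sum f b) UNIV"
  by (rule has_sum_cong_neutral[THEN iffD1, OF _ _ _ has_sum_finiteI[of "{b}" _ f]]) auto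

lemma power_series_on_abs_summable:
  assumes "power_series_on R A f" "\<And>j. cmod (z $ j) < R"
  shows "(\<lambda>a. cmod (A a * monomial a z)) summable_on UNIV"
  using assms summable_on_iff_abs_summable_on_complex[of "\<lambda>a. A a * monomial a z" UNIV]
  by (auto simp: power_series_on_def summable_on_def)

lemma integral_monomial_torus:
  "(\<integral>\<theta>. monomial a (torus_point \<theta>) * cnj (monomial b (torus_point \<theta>)) \<partial>angles) = (if a = b then 1 else 0)"
proof -
  have "(\<integral>\<theta>. monomial a (torus_point \<theta>) * cnj (monomial b (torus_point \<theta>)) \<partial>angles) =
      (\<integral>\<theta>. (\<Prod>j\<in>UNIV. cis (\<theta> j) ^ a j * cnj (cis (\<theta> j) ^ b j)) \<partial>(\<Pi>\<^sub>M j\<in>UNIV. angle_measure))"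
    by (simp add: monomial_def torus_point_def angles_def prod.distrib)
  also have "\<dots> = (\<Prod>j\<in>UNIV. \<integral>t. cis t ^ a j * cnj (cis t ^ b j) \<partial>angle_measure)"
    by (intro angle_prod.product_integral_prod integrable_angle_measure[where B = 1])
      (auto intro!: continuous_intros simp: norm_mult norm_power)
  also have "\<dots> = (if a = b then 1 else 0)"
    unfolding integral_cis_angle_measure by (auto simp: fun_eq_iff)
  finally show ?thesis .
qed

text \<open>On the torus of radius \<open>s\<close> the monomials are orthogonal, so integrating the
  series term by term against \<open>cnj (monomial b)\<close> leaves a single term.\<close>

lemma power_series_on_fourier:
  fixes f :: "complex^'n::finite \<Rightarrow> complex"
  assumes ps: "power_series_on R A f" and s: "0 < s" "s < R"
  shows "(\<lambda>\<theta>. f (s *\<^sub>R torus_point \<theta>)) \<in> borel_measurable angles"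
    and "fourier_coeff f s b = A b * of_real (s ^ total_degree b)"
proof -
  have sum: "((\<lambda>a. A a * monomial a (s *\<^sub>R torus_point \<theta>)) has_sum f (s *\<^sub>R torus_point \<theta>)) UNIV" for \<theta>
    using ps s by (simp add: power_series_on_def)
  have summ: "(\<lambda>a. cmod (A a) * s ^ total_degree a) summable_on UNIV"
    \<comment> \<open>All points of the torus give the terms the same modulus
      \<open>|A a| s^|a|\<close>; angle zero, the point \<open>(s, ..., s)\<close>, serves as
      representative for the dominating series.\<close>
    using power_series_on_abs_summable[OF ps, of "s *\<^sub>R torus_point (\<lambda>_. 0)"] s
    by (simp add: monomial_scaleR norm_mult norm_power)
  show "(\<lambda>\<theta>. f (s *\<^sub>R torus_point \<theta>)) \<in> borel_measurable angles"
    by (rule angles.has_sum_integral(1)[OF _ _ summ sum]) (use s in \<open>auto simp: monomial_scaleR norm_mult norm_power\<close>)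
  let ?g = "\<lambda>a \<theta>. A a * monomial a (s *\<^sub>R torus_point \<theta>) * cnj (monomial b (torus_point \<theta>))"
  have "((\<lambda>a. \<integral>\<theta>. ?g a \<theta> \<partial>angles) has_sum fourier_coeff f s b) UNIV"
    unfolding fourier_coeff_def
    by (rule angles.has_sum_integral(2)[OF _ _ summ has_sum_cmult_left[OF sum]])
      (use s in \<open>auto simp: monomial_scaleR norm_mult norm_power\<close>)
  moreover have "(\<integral>\<theta>. ?g a \<theta> \<partial>angles) = (if a = b then A a * of_real (s ^ total_degree a) else 0)" for a
  proof -
    have "(\<integral>\<theta>. ?g a \<theta> \<partial>angles) = (\<integral>\<theta>. (A a * of_real (s ^ total_degree a)) *
        (monomial a (torus_point \<theta>) * cnj (monomial b (torus_point \<theta>))) \<partial>angles)"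
      by (simp add: monomial_scaleR mult_ac)
    then show ?thesis
      by (simp only: Bochner_Integration.integral_mult_right_zero integral_monomial_torus) simp
  qed
  ultimately have "((\<lambda>a. if a = b then A a * of_real (s ^ total_degree a) else 0) has_sum fourier_coeff f s b) UNIV"
    by simp
  then show "fourier_coeff f s b = A b * of_real (s ^ total_degree b)"
    by (rule has_sum_unique) (rule has_sum_delta)
qed

lemma power_series_on_unique:
  assumes "power_series_on R A f" "power_series_on R' B f" "R > 0" "R' > 0"
  shows "A = B"
proof
  fix b
  define s where "s = min R R' / 2"
  have "0 < s" "s < R" "s < R'" using assms by (auto simp: s_def)
  then have "A b * of_real (s ^ total_degree b) = B b * of_real (s ^ total_degree b)"
    using power_series_on_fourier(2)[OF assms(1)] power_series_on_fourier(2)[OF assms(2)] by metis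
  then show "A b = B b" using \<open>0 < s\<close> by simp
qed

text \<open>The Cauchy kernel is the product over \<open>j\<close> of the geometric series in
  \<open>z_j e^(-i\<theta>_j) / r\<close>. Because \<open>|z_j| < r\<close>, their product series is
  dominated uniformly in the angles and may be integrated term by term.\<close>

lemma polydisk_analytic_power_series_radius:
  fixes f :: "complex^'n::finite \<Rightarrow> complex"
  assumes f: "polydisk_analytic f" and r: "0 < r" "r < 1"
  shows "power_series_on r (\<lambda>a. fourier_coeff f r a / of_real (r ^ total_degree a)) f"
  unfolding power_series_on_def
proof (intro allI impI)
  fix z :: "complex^'n" assume z: "\<forall>j. cmod (z $ j) < r"
  have cont: "continuous_on polydisk f" by (rule polydisk_analytic_continuous_on[OF f])
  obtain B where B: "B \<ge> 0" "\<And>z. (\<And>j. cmod (z $ j) \<le> r) \<Longrightarrow> cmod (f z) \<le> B"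
    using continuous_on_polydisk_bounded[OF cont r(2)] by metis
  let ?F = "\<lambda>\<theta>. f (r *\<^sub>R torus_point \<theta>)"
  let ?c = "of_real r :: complex"
  let ?q = "\<lambda>j. z $ j / ?c"
  let ?g = "\<lambda>a \<theta>. ?F \<theta> * (\<Prod>j\<in>UNIV. (?q j * cis (- \<theta> j)) ^ a j)"
  have q: "cmod (?q j) < 1" for j using z r by (simp add: norm_divide)
  have geom: "((\<lambda>m. w ^ m) has_sum (1 / (1 - w))) UNIV" if "cmod w < 1" for w :: complex
    using that by (intro norm_summable_imp_has_sum geometric_sums) (auto simp: norm_power intro: summable_geometric)
  have [measurable]: "?F \<in> borel_measurable angles"
    using r by (intro borel_measurable_polydisk_comp[OF cont]) (auto simp: polydisk_def)
  have gm: "?g a = (\<lambda>\<theta>. (\<Prod>j\<in>UNIV. ?q j ^ a j) * (?F \<theta> * cnj (monomial a (torus_point \<theta>))))" for a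
  proof
    fix \<theta>
    have "(?q j * cis (- \<theta> j)) ^ a j = ?q j ^ a j * cnj (cis (\<theta> j) ^ a j)" for j
      by (simp only: power_mult_distrib complex_cnj_power cis_cnj)
    then show "?g a \<theta> = (\<Prod>j\<in>UNIV. ?q j ^ a j) * (?F \<theta> * cnj (monomial a (torus_point \<theta>)))"
      by (simp add: monomial_def torus_point_def prod.distrib mult_ac)
  qed
  have "((\<lambda>a. \<integral>\<theta>. ?g a \<theta> \<partial>angles) has_sum
      (\<integral>\<theta>. ?F \<theta> * (\<Prod>j\<in>UNIV. 1 / (1 - ?q j * cis (- \<theta> j))) \<partial>angles)) UNIV"
  proof (rule angles.has_sum_integral(2))
    show "?g a \<in> borel_measurable angles" for a
      unfolding gm by measurable
    show "norm (?g a \<theta>) \<le> B * norm (\<Prod>j\<in>UNIV. ?q j ^ a j)" for a \<theta>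
      using B(2)[of "r *\<^sub>R torus_point \<theta>"] r
      by (subst fun_cong[OF gm[of a], of \<theta>]) (simp add: norm_mult mult.commute mult_right_mono)
    have "((\<lambda>a. \<Prod>j\<in>UNIV. ?q j ^ a j) has_sum (\<Prod>j\<in>UNIV. 1 / (1 - ?q j))) UNIV"
      by (intro has_sum_prod_fun geom q)
    then have "(\<lambda>a. \<Prod>j\<in>UNIV. ?q j ^ a j) summable_on UNIV"
      by (auto simp: summable_on_def)
    then show "(\<lambda>a. B * norm (\<Prod>j\<in>UNIV. ?q j ^ a j)) summable_on UNIV"
      using summable_on_iff_abs_summable_on_complex[of "\<lambda>a. \<Prod>j\<in>UNIV. ?q j ^ a j" UNIV]
      by (intro summable_on_cmult_right) blast
    show "((\<lambda>a. ?g a \<theta>) has_sum ?F \<theta> * (\<Prod>j\<in>UNIV. 1 / (1 - ?q j * cis (- \<theta> j)))) UNIV" for \<theta>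
      using q by (intro has_sum_cmult_right has_sum_prod_fun geom) (simp add: norm_mult norm_divide)
  qed
  moreover have "(\<integral>\<theta>. ?F \<theta> * (\<Prod>j\<in>UNIV. 1 / (1 - ?q j * cis (- \<theta> j))) \<partial>angles) = f z"
  proof -
    have "(\<chi> i. if i \<in> UNIV then ?c * cis (\<theta> i) else z $ i) = r *\<^sub>R torus_point \<theta>" for \<theta>
      by (simp add: vec_eq_iff torus_point_def) (simp add: scaleR_conv_of_real)
    then show ?thesis
      using polydisk_Cauchy_integral[OF f r(2), of UNIV z] z by (simp add: angles_def)
  qed
  moreover have "(\<integral>\<theta>. ?g a \<theta> \<partial>angles) = fourier_coeff f r a / of_real (r ^ total_degree a) * monomial a z" for a
  proof -
    have "(\<Prod>j\<in>UNIV. ?q j ^ a j) = monomial a z / of_real (r ^ total_degree a)"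
      by (simp add: monomial_def total_degree_def power_divide prod_dividef power_sum)
    then show ?thesis
      unfolding gm fourier_coeff_def by (simp only: Bochner_Integration.integral_mult_right_zero) simp
  qed
  ultimately show "((\<lambda>a. fourier_coeff f r a / of_real (r ^ total_degree a) * monomial a z) has_sum f z) UNIV"
    by simp
qed

theorem polydisk_analytic_power_series:
  fixes f :: "complex^'n::finite \<Rightarrow> complex"
  assumes f: "polydisk_analytic f"
  obtains A where "power_series_on 1 A f"
proof
  define A where "A r a = fourier_coeff f r a / of_real (r ^ total_degree a)" for r a
  have ps: "power_series_on r (A r) f" if "0 < r" "r < 1" for r
    unfolding A_def using polydisk_analytic_power_series_radius[OF f that] .
  show "power_series_on 1 (A (1/2)) f"
    unfolding power_series_on_def
  proof (intro allI impI)
    fix z :: "complex^'n" assume z: "\<forall>j. cmod (z $ j) < 1"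
    define m where "m = Max (range (\<lambda>j. cmod (z $ j)))"
    have m: "m < 1" "\<And>j. cmod (z $ j) \<le> m" using z by (auto simp: m_def)
    have "0 \<le> m" using m(2)[of undefined] norm_ge_zero order_trans by blast
    then obtain r where r: "m < r" "0 < r" "r < 1" using m dense[of m 1] by auto
    \<comment> \<open>The coefficients read off at radius \<open>r\<close> do not depend on \<open>r\<close>.\<close>
    have "A r = A (1/2)"
      by (rule power_series_on_unique[OF ps ps]) (use r in auto)
    with ps[OF r(2,3)] show "((\<lambda>a. A (1/2) a * monomial a z) has_sum f z) UNIV"
      using r(1) m(2) by (auto simp: power_series_on_def intro: le_less_trans)
  qed
qed

section \<open>The Hardy space and its monomials\<close>

text \<open>Membership in \<open>hardy_space\<close> without the bound on the means. Parseval is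
  available at this level and is then used to prove that bound for new functions.\<close>

definition polydisk_analytic0 :: "(complex^'n::finite \<Rightarrow> complex) \<Rightarrow> bool" where
  "polydisk_analytic0 f \<longleftrightarrow> polydisk_analytic f \<and> (\<forall>z. z \<notin> polydisk \<longrightarrow> f z = 0)"

text \<open>The cut-off is forced by the convention that elements of \<open>hardy_space\<close>
  vanish outside the polydisk.\<close>

definition hardy_monomial :: "('n::finite \<Rightarrow> nat) \<Rightarrow> complex^'n \<Rightarrow> complex" where
  "hardy_monomial a z = (if z \<in> polydisk then monomial a z else 0)"

lemma hardy_space_iff:
  "f \<in> hardy_space \<longleftrightarrow> polydisk_analytic0 f \<and> bdd_above (torus_mean f ` {0<..<1})"
  by (auto simp: hardy_space_def polydisk_analytic0_def)

lemma torus_haar_eq: "torus_haar = distr angles borel torus_point"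
  by (simp add: torus_haar_def angles_def angle_measure_def torus_point_def[abs_def])

text \<open>A change of variables asks for \<open>f\<close> to be Borel on the whole space; being
  continuous on an open set and zero elsewhere provides this.\<close>

lemma torus_mean_eq:
  assumes f: "polydisk_analytic0 f"
  shows "torus_mean f r = (\<integral>\<theta>. (cmod (f (r *\<^sub>R torus_point \<theta>)))\<^sup>2 \<partial>angles)"
proof -
  have "(\<lambda>z. indicator polydisk z *\<^sub>R f z) \<in> borel_measurable borel"
    using f by (intro borel_measurable_continuous_on_indicator borel_open open_polydisk
        polydisk_analytic_continuous_on) (simp add: polydisk_analytic0_def)
  also have "(\<lambda>z. indicator polydisk z *\<^sub>R f z) = f"
    using f by (auto simp: polydisk_analytic0_def fun_eq_iff indicator_def)
  finally have [measurable]: "f \<in> borel_measurable borel" .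
  show ?thesis
    unfolding torus_mean_def torus_haar_eq by (subst integral_distr) auto
qed

text \<open>In \<open>f * cnj f\<close> only the first factor is expanded; the second stays a
  bounded function. The term at \<open>a\<close> then integrates to \<open>A a r^|a|\<close> times
  the conjugate of a Fourier coefficient, and no double series arises.\<close>

lemma torus_mean_Parseval:
  assumes f: "polydisk_analytic0 f" and ps: "power_series_on 1 A f" and r: "0 < r" "r < 1"
  shows "((\<lambda>a. (cmod (A a))\<^sup>2 * r ^ (2 * total_degree a)) has_sum torus_mean f r) UNIV"
proof -
  let ?F = "\<lambda>\<theta>. f (r *\<^sub>R torus_point \<theta>)"
  have cont: "continuous_on polydisk f"
    using f by (simp add: polydisk_analytic0_def polydisk_analytic_continuous_on)
  obtain B where B: "B \<ge> 0" "\<And>z. (\<And>j. cmod (z $ j) \<le> r) \<Longrightarrow> cmod (f z) \<le> B"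
    using continuous_on_polydisk_bounded[OF cont r(2)] by metis
  have FB: "cmod (?F \<theta>) \<le> B" for \<theta> using r by (intro B) simp
  note fourier = power_series_on_fourier[OF ps r]
  note [measurable] = fourier(1)
  have summ: "(\<lambda>a. cmod (A a) * r ^ total_degree a * B) summable_on UNIV"
    using power_series_on_abs_summable[OF ps, of "r *\<^sub>R torus_point (\<lambda>_. 0)"] r
    by (intro summable_on_cmult_left) (simp add: monomial_scaleR norm_mult norm_power)
  let ?g = "\<lambda>a \<theta>. A a * monomial a (r *\<^sub>R torus_point \<theta>) * cnj (?F \<theta>)"
  have "((\<lambda>a. \<integral>\<theta>. ?g a \<theta> \<partial>angles) has_sum (\<integral>\<theta>. ?F \<theta> * cnj (?F \<theta>) \<partial>angles)) UNIV"
  proof (rule angles.has_sum_integral(2)[OF _ _ summ])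
    show "?g a \<in> borel_measurable angles" for a
      unfolding monomial_scaleR by measurable
    show "norm (?g a \<theta>) \<le> cmod (A a) * r ^ total_degree a * B" for a \<theta>
      using FB[of \<theta>] r by (auto simp: monomial_scaleR norm_mult norm_power intro!: mult_left_mono)
    show "((\<lambda>a. ?g a \<theta>) has_sum ?F \<theta> * cnj (?F \<theta>)) UNIV" for \<theta>
      using ps r by (intro has_sum_cmult_left) (simp add: power_series_on_def)
  qed
  moreover have "(\<integral>\<theta>. ?g a \<theta> \<partial>angles) = of_real ((cmod (A a))\<^sup>2 * r ^ (2 * total_degree a))" for a
  proof -
    have "(\<integral>\<theta>. ?g a \<theta> \<partial>angles) = (\<integral>\<theta>. (A a * of_real (r ^ total_degree a)) *
        cnj (?F \<theta> * cnj (monomial a (torus_point \<theta>))) \<partial>angles)"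
      by (simp add: monomial_scaleR mult_ac)
    also have "\<dots> = A a * of_real (r ^ total_degree a) * cnj (fourier_coeff f r a)"
      by (simp only: Bochner_Integration.integral_mult_right_zero fourier_coeff_def
          Bochner_Integration.integral_cnj)
    also have "\<dots> = of_real ((cmod (A a))\<^sup>2 * r ^ (2 * total_degree a))"
    proof -
      have "A a * of_real (r ^ total_degree a) * cnj (A a * of_real (r ^ total_degree a)) =
          (A a * cnj (A a)) * of_real (r ^ (2 * total_degree a))"
        by (simp add: mult_2 power_add)
      then show ?thesis
        unfolding fourier(2) complex_norm_square[symmetric] by simp
    qed
    finally show ?thesis .
  qed
  moreover have "(\<integral>\<theta>. ?F \<theta> * cnj (?F \<theta>) \<partial>angles) = of_real (torus_mean f r)"
    unfolding torus_mean_eq[OF f] integral_complex_of_real[symmetric] complex_norm_square by (rule refl)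
  ultimately have "((\<lambda>a. of_real ((cmod (A a))\<^sup>2 * r ^ (2 * total_degree a)) :: complex) has_sum of_real (torus_mean f r)) UNIV"
    by simp
  from has_sum_Re[OF this] show ?thesis by simp
qed

lemma torus_mean_mono:
  assumes "polydisk_analytic0 f" "0 < r" "r \<le> s" "s < 1"
  shows "torus_mean f r \<le> torus_mean f s"
proof -
  obtain A where ps: "power_series_on 1 A f"
    using assms polydisk_analytic_power_series[of f] by (auto simp: polydisk_analytic0_def)
  show ?thesis
    by (rule has_sum_mono[OF torus_mean_Parseval[OF assms(1) ps] torus_mean_Parseval[OF assms(1) ps]])
      (use assms in \<open>auto intro!: mult_left_mono power_mono\<close>)
qed

lemma torus_mean_nonneg: "torus_mean f r \<ge> 0"
  unfolding torus_mean_def by (intro Bochner_Integration.integral_nonneg) simp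

text \<open>The means increase with the radius, so their supremum is their limit at
  \<open>1\<close>. Unlike suprema, limits are additive, which lets identities for the means pass to
  the norm.\<close>

lemma hardy_norm_tendsto:
  assumes "f \<in> hardy_space"
  shows "(torus_mean f \<longlongrightarrow> (hardy_norm f)\<^sup>2) (at_left 1)"
proof -
  have f: "polydisk_analytic0 f" and bdd: "bdd_above (torus_mean f ` {0<..<1})"
    using assms by (auto simp: hardy_space_iff)
  have ne: "{0<..<1::real} \<noteq> {}" by simp
  let ?S = "SUP r\<in>{0<..<1}. torus_mean f r"
  have up: "torus_mean f r \<le> ?S" if "r \<in> {0<..<1}" for r
    using bdd that by (rule cSUP_upper2) simp
  have "0 \<le> ?S" using torus_mean_nonneg[of f "1/2"] up[of "1/2"] by simp
  then have eq: "(hardy_norm f)\<^sup>2 = ?S" by (simp add: hardy_norm_def)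
  show ?thesis unfolding eq
  proof (rule order_tendstoI)
    fix a assume "a < ?S"
    then obtain r where r: "r \<in> {0<..<1}" "a < torus_mean f r"
      using less_cSUP_iff[OF ne bdd] by blast
    have "\<forall>\<^sub>F s in at_left 1. s \<in> {r<..<1}"
      using r by (intro eventually_at_leftI[of r]) auto
    then show "\<forall>\<^sub>F s in at_left 1. a < torus_mean f s"
    proof eventually_elim
      case (elim s)
      have "torus_mean f r \<le> torus_mean f s" by (rule torus_mean_mono[OF f]) (use r elim in auto)
      with r show ?case by simp
    qed
  next
    fix a assume a: "?S < a"
    have "\<forall>\<^sub>F s in at_left 1. s \<in> {0<..<1::real}"
      by (intro eventually_at_leftI[of 0]) auto
    then show "\<forall>\<^sub>F s in at_left 1. torus_mean f s < a"
      by eventually_elim (rule le_less_trans[OF up a])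
  qed
qed

section \<open>Monomials and inner products with them\<close>

lemma polydisk_analytic_cong:
  assumes "\<And>z. z \<in> polydisk \<Longrightarrow> f z = g z"
  shows "polydisk_analytic f \<longleftrightarrow> polydisk_analytic g"
proof -
  have "polydisk_analytic g" if "polydisk_analytic f" and eq: "\<And>z. z \<in> polydisk \<Longrightarrow> f z = g z" for f g :: "complex^'a \<Rightarrow> complex"
    unfolding polydisk_analytic_def
  proof
    fix z :: "complex^'a" assume z: "z \<in> polydisk"
    then obtain a where "(f has_derivative (\<lambda>h. \<Sum>j\<in>UNIV. a $ j * h $ j)) (at z)"
      using \<open>polydisk_analytic f\<close> by (auto simp: polydisk_analytic_def)
    from has_derivative_transform_within_open[OF this open_polydisk z]
    show "\<exists>a. (g has_derivative (\<lambda>h. \<Sum>j\<in>UNIV. a $ j * h $ j)) (at z)"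
      using eq by blast
  qed
  from this[of f g] this[of g f] assms show ?thesis by auto
qed

lemma polydisk_analytic_monomial: "polydisk_analytic (monomial a)"
  unfolding polydisk_analytic_def
proof
  fix z :: "complex^'a"
  let ?c = "\<lambda>j. of_nat (a j) * z $ j ^ (a j - 1) * (\<Prod>i\<in>UNIV - {j}. z $ i ^ a i)"
  have "((\<lambda>z. z $ j ^ a j) has_derivative (\<lambda>h. of_nat (a j) * z $ j ^ (a j - 1) * h $ j)) (at z)" for j
    by (auto intro!: derivative_eq_intros bounded_linear_imp_has_derivative bounded_linear_vec_nth simp: fun_eq_iff mult_ac)
  then have "(monomial a has_derivative (\<lambda>h. \<Sum>j\<in>UNIV. of_nat (a j) * z $ j ^ (a j - 1) * h $ j * (\<Prod>i\<in>UNIV - {j}. z $ i ^ a i))) (at z)"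
    unfolding monomial_def[abs_def] by (rule has_derivative_prod)
  also have "(\<lambda>h. \<Sum>j\<in>UNIV. of_nat (a j) * z $ j ^ (a j - 1) * h $ j * (\<Prod>i\<in>UNIV - {j}. z $ i ^ a i)) =
      (\<lambda>h. \<Sum>j\<in>UNIV. (\<chi> j. ?c j) $ j * h $ j)"
    by (simp add: mult_ac)
  finally show "\<exists>c. (monomial a has_derivative (\<lambda>h. \<Sum>j\<in>UNIV. c $ j * h $ j)) (at z)" by blast
qed

lemma polydisk_analytic_add_cmult:
  assumes "polydisk_analytic f" "polydisk_analytic g"
  shows "polydisk_analytic (\<lambda>z. f z + c * g z)"
  unfolding polydisk_analytic_def
proof
  fix z :: "complex^'a" assume z: "z \<in> polydisk"
  obtain a where a: "(f has_derivative (\<lambda>h. \<Sum>j\<in>UNIV. a $ j * h $ j)) (at z)"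
    using assms z by (auto simp: polydisk_analytic_def)
  obtain b where b: "(g has_derivative (\<lambda>h. \<Sum>j\<in>UNIV. b $ j * h $ j)) (at z)"
    using assms z by (auto simp: polydisk_analytic_def)
  have "((\<lambda>z. f z + c * g z) has_derivative
      (\<lambda>h. (\<Sum>j\<in>UNIV. a $ j * h $ j) + c * (\<Sum>j\<in>UNIV. b $ j * h $ j))) (at z)"
    by (intro derivative_intros a b)
  also have "(\<lambda>h. (\<Sum>j\<in>UNIV. a $ j * h $ j) + c * (\<Sum>j\<in>UNIV. b $ j * h $ j)) =
      (\<lambda>h. \<Sum>j\<in>UNIV. (\<chi> j. a $ j + c * b $ j) $ j * h $ j)"
    by (simp add: sum_distrib_left sum.distrib algebra_simps)
  finally show "\<exists>a. ((\<lambda>z. f z + c * g z) has_derivative (\<lambda>h. \<Sum>j\<in>UNIV. a $ j * h $ j)) (at z)"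
    by blast
qed

lemma power_series_on_cong:
  assumes "\<And>z. z \<in> polydisk \<Longrightarrow> f z = g z"
  shows "power_series_on 1 A f \<longleftrightarrow> power_series_on 1 A g"
  using assms by (auto simp: power_series_on_def polydisk_def)

lemma power_series_on_monomial: "power_series_on R (\<lambda>a. if a = b then 1 else 0) (monomial b)"
  unfolding power_series_on_def
proof (intro allI impI)
  fix z :: "complex^'a"
  have "(\<lambda>a. (if a = b then 1 else 0) * monomial a z) = (\<lambda>a. if a = b then monomial a z else 0)"
    by (simp add: fun_eq_iff)
  then show "((\<lambda>a. (if a = b then 1 else 0) * monomial a z) has_sum monomial b z) UNIV"
    using has_sum_delta[of b "\<lambda>a. monomial a z"] by simp
qed

lemma power_series_on_hardy_monomial:
  "power_series_on 1 (\<lambda>a. if a = b then 1 else 0) (hardy_monomial b)"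
  using power_series_on_monomial[of 1 b]
  by (subst power_series_on_cong[of _ "monomial b"]) (auto simp: hardy_monomial_def)

lemma power_series_on_add_cmult:
  assumes "power_series_on R A f" "power_series_on R B g"
  shows "power_series_on R (\<lambda>a. A a + c * B a) (\<lambda>z. f z + c * g z)"
  unfolding power_series_on_def
proof (intro allI impI)
  fix z :: "complex^'a" assume "\<forall>j. cmod (z $ j) < R"
  then have "((\<lambda>a. A a * monomial a z + c * (B a * monomial a z)) has_sum (f z + c * g z)) UNIV"
    using assms by (intro has_sum_add has_sum_cmult_right) (auto simp: power_series_on_def)
  then show "((\<lambda>a. (A a + c * B a) * monomial a z) has_sum f z + c * g z) UNIV"
    by (simp add: algebra_simps)
qed

lemma polydisk_analytic0_hardy_monomial: "polydisk_analytic0 (hardy_monomial a)"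
  using polydisk_analytic_monomial[of a] polydisk_analytic_cong[of "hardy_monomial a" "monomial a"]
  by (auto simp: polydisk_analytic0_def hardy_monomial_def)

text \<open>Adding \<open>c z^b\<close> alters one coefficient, so by Parseval each mean changes by
  exactly \<open>?d * r^(2|b|)\<close>. This is bounded in \<open>r\<close>, giving membership, and
  tends to \<open>?d\<close> as \<open>r\<close> tends to \<open>1\<close>, giving the norm.\<close>

lemma hardy_add_monomial:
  fixes b :: "'n::finite \<Rightarrow> nat"
  assumes f: "f \<in> hardy_space" and ps: "power_series_on 1 A f"
  shows "(\<lambda>z. f z + c * hardy_monomial b z) \<in> hardy_space" (is "?h \<in> _")
    and "(hardy_norm (\<lambda>z. f z + c * hardy_monomial b z))\<^sup>2 =
           (hardy_norm f)\<^sup>2 + ((cmod (A b + c))\<^sup>2 - (cmod (A b))\<^sup>2)"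
proof -
  let ?d = "(cmod (A b + c))\<^sup>2 - (cmod (A b))\<^sup>2"
  have f0: "polydisk_analytic0 f" using f by (simp add: hardy_space_iff)
  have h0: "polydisk_analytic0 ?h"
    using f0 polydisk_analytic0_hardy_monomial[of b]
    by (auto simp: polydisk_analytic0_def intro: polydisk_analytic_add_cmult)
  have psh: "power_series_on 1 (\<lambda>a. A a + c * (if a = b then 1 else 0)) ?h"
    by (intro power_series_on_add_cmult ps power_series_on_hardy_monomial)
  have tm: "torus_mean ?h r = torus_mean f r + ?d * r ^ (2 * total_degree b)" if r: "0 < r" "r < 1" for r
  proof -
    have "((\<lambda>a. (cmod (A a))\<^sup>2 * r ^ (2 * total_degree a) + (if a = b then ?d * r ^ (2 * total_degree a) else 0))
        has_sum (torus_mean f r + ?d * r ^ (2 * total_degree b))) UNIV"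
      by (intro has_sum_add torus_mean_Parseval f0 ps r
          has_sum_delta[of b "\<lambda>a. ?d * r ^ (2 * total_degree a)"])
    also have "(\<lambda>a. (cmod (A a))\<^sup>2 * r ^ (2 * total_degree a) + (if a = b then ?d * r ^ (2 * total_degree a) else 0)) =
        (\<lambda>a. (cmod (A a + c * (if a = b then 1 else 0)))\<^sup>2 * r ^ (2 * total_degree a))"
      by (rule ext) (simp add: algebra_simps)
    finally show ?thesis
      by (rule has_sum_unique[OF torus_mean_Parseval[OF h0 psh r]])
  qed
  obtain M where M: "\<And>r. r \<in> {0<..<1} \<Longrightarrow> torus_mean f r \<le> M"
    using f by (force simp: hardy_space_iff bdd_above_def)
  have "torus_mean ?h r \<le> M + \<bar>?d\<bar>" if r: "r \<in> {0<..<1}" for r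
  proof -
    have "?d * r ^ (2 * total_degree b) \<le> \<bar>?d\<bar> * 1"
      using r by (intro mult_mono power_le_one) auto
    then show ?thesis using M[OF r] r tm[of r] by simp
  qed
  then have "bdd_above (torus_mean ?h ` {0<..<1})" by (intro bdd_aboveI2)
  with h0 show h: "?h \<in> hardy_space" by (simp add: hardy_space_iff)
  have "((\<lambda>r. torus_mean f r + ?d * r ^ (2 * total_degree b)) \<longlongrightarrow> (hardy_norm f)\<^sup>2 + ?d * 1 ^ (2 * total_degree b)) (at_left 1)"
    by (intro tendsto_intros hardy_norm_tendsto f)
  moreover have "\<forall>\<^sub>F r in at_left 1. torus_mean f r + ?d * r ^ (2 * total_degree b) = torus_mean ?h r"
    by (intro eventually_at_leftI[of 0]) (auto simp: tm)
  ultimately have "(torus_mean ?h \<longlongrightarrow> (hardy_norm f)\<^sup>2 + ?d) (at_left 1)"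
    by (simp add: filterlim_cong[OF refl refl, of "\<lambda>r. torus_mean f r + ?d * r ^ (2 * total_degree b)" "torus_mean ?h"])
  then show "(hardy_norm ?h)\<^sup>2 = (hardy_norm f)\<^sup>2 + ?d"
    by (intro tendsto_unique[OF _ hardy_norm_tendsto[OF h]]) auto
qed

lemma zero_in_hardy_space: "(\<lambda>_. 0) \<in> hardy_space"
proof -
  have "(\<lambda>h. \<Sum>j\<in>UNIV. (0 :: complex^'a) $ j * h $ j) = (\<lambda>_. 0)" by (simp add: fun_eq_iff)
  then have "polydisk_analytic (\<lambda>_ :: complex^'a. 0)"
    unfolding polydisk_analytic_def by (intro ballI exI[of _ 0]) simp
  then show ?thesis
    by (auto simp: hardy_space_def torus_mean_def bdd_above_def)
qed

lemma hardy_monomial_in_hardy_space: "hardy_monomial b \<in> hardy_space"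
proof -
  have "power_series_on 1 (\<lambda>_. 0) (\<lambda>_. 0)" by (simp add: power_series_on_def)
  from hardy_add_monomial(1)[OF zero_in_hardy_space this, of 1 b] show ?thesis by simp
qed

text \<open>Polarization uses \<open>c = 1, -1, \<i>, -\<i>\<close> in the preceding norm formula.
  The norm of \<open>f\<close> cancels, and \<open>|A+1|^2 - |A-1|^2 = 4 Re A\<close>,
  \<open>|A+\<i>|^2 - |A-\<i>|^2 = 4 Im A\<close>.\<close>

lemma hardy_inner_monomial_right:
  assumes f: "f \<in> hardy_space" and ps: "power_series_on 1 A f"
  shows "hardy_inner f (hardy_monomial b) = A b"
proof -
  note N = hardy_add_monomial(2)[OF f ps, of _ b]
  have "hardy_inner f (hardy_monomial b) =
      Complex (((cmod (A b + 1))\<^sup>2 - (cmod (A b + (-1)))\<^sup>2) / 4) (((cmod (A b + \<i>))\<^sup>2 - (cmod (A b + (-\<i>)))\<^sup>2) / 4)"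
    unfolding hardy_inner_def using N[of 1] N[of "-1"] N[of \<i>] N[of "-\<i>"] by simp
  also have "\<dots> = A b"
    unfolding cmod_power2 by (simp add: complex_eq_iff power2_eq_square algebra_simps)
  finally show ?thesis .
qed

lemma hardy_norm_cong: "(\<And>z. cmod (f z) = cmod (g z)) \<Longrightarrow> hardy_norm f = hardy_norm g"
  by (simp add: hardy_norm_def torus_mean_def)

text \<open>Factors \<open>\<i>\<close> and \<open>-\<i>\<close> do not affect the norm, so
  exchanging the arguments exchanges the two norms in the imaginary part. It moves a monomial from
  the left slot, where the adjoint leaves it, to the right one.\<close>

lemma hardy_inner_commute: "hardy_inner g f = cnj (hardy_inner f g)"
proof -
  have "hardy_norm (\<lambda>z. g z + f z) = hardy_norm (\<lambda>z. f z + g z)"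
    by (simp add: add.commute)
  moreover have "hardy_norm (\<lambda>z. g z - f z) = hardy_norm (\<lambda>z. f z - g z)"
    by (intro hardy_norm_cong) (simp add: norm_minus_commute)
  moreover have "hardy_norm (\<lambda>z. g z + \<i> * f z) = hardy_norm (\<lambda>z. f z - \<i> * g z)"
  proof (rule hardy_norm_cong)
    fix z
    have "g z + \<i> * f z = \<i> * (f z - \<i> * g z)" by (simp add: algebra_simps)
    then show "cmod (g z + \<i> * f z) = cmod (f z - \<i> * g z)" by (simp add: norm_mult)
  qed
  moreover have "hardy_norm (\<lambda>z. g z - \<i> * f z) = hardy_norm (\<lambda>z. f z + \<i> * g z)"
  proof (rule hardy_norm_cong)
    fix z
    have "g z - \<i> * f z = - \<i> * (f z + \<i> * g z)" by (simp add: algebra_simps)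
    then show "cmod (g z - \<i> * f z) = cmod (f z + \<i> * g z)" by (simp add: norm_mult)
  qed
  ultimately show ?thesis by (simp add: hardy_inner_def complex_eq_iff field_simps)
qed

section \<open>The conjugation on power series\<close>

lemma hardy_conj_power_series:
  assumes "power_series_on 1 A f"
  shows "power_series_on 1 (\<lambda>a. cnj (A a)) (hardy_conj f)"
  unfolding power_series_on_def
proof (intro allI impI)
  fix z :: "complex^'a" assume "\<forall>j. cmod (z $ j) < 1"
  then have "((\<lambda>a. A a * monomial a (\<chi> j. cnj (z $ j))) has_sum f (\<chi> j. cnj (z $ j))) UNIV"
    using assms by (auto simp: power_series_on_def)
  then have "((\<lambda>a. cnj (A a * monomial a (\<chi> j. cnj (z $ j)))) has_sum cnj (f (\<chi> j. cnj (z $ j)))) UNIV"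
    by (simp only: has_sum_cnj_iff)
  then show "((\<lambda>a. cnj (A a) * monomial a z) has_sum hardy_conj f z) UNIV"
    by (simp add: monomial_def hardy_conj_def)
qed

text \<open>The inner conjugation makes the derivative conjugate linear and the outer one makes it
  complex linear again, with conjugated gradient. The means agree by Parseval, as the coefficients
  keep their moduli.\<close>

lemma hardy_conj_in_hardy_space:
  fixes f :: "complex^'n::finite \<Rightarrow> complex"
  assumes f: "f \<in> hardy_space"
  shows "hardy_conj f \<in> hardy_space"
proof -
  have f0: "polydisk_analytic0 f" using f by (simp add: hardy_space_iff)
  let ?c = "\<lambda>z::complex^'n. \<chi> j. cnj (z $ j)"
  have c_pd: "?c z \<in> polydisk \<longleftrightarrow> z \<in> polydisk" for z by (simp add: polydisk_def)
  have lin: "bounded_linear ?c"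
    unfolding linear_conv_bounded_linear[symmetric] by (intro linearI) (auto simp: vec_eq_iff)
  have "polydisk_analytic (hardy_conj f)"
    unfolding polydisk_analytic_def
  proof
    fix z :: "complex^'n" assume "z \<in> polydisk"
    then obtain a where "(f has_derivative (\<lambda>h. \<Sum>j\<in>UNIV. a $ j * h $ j)) (at (?c z))"
      using f0 c_pd[of z] by (auto simp: polydisk_analytic0_def polydisk_analytic_def)
    from diff_chain_at[OF bounded_linear_imp_has_derivative[OF lin] this]
    have "((\<lambda>z. f (?c z)) has_derivative (\<lambda>h. \<Sum>j\<in>UNIV. a $ j * cnj (h $ j))) (at z)"
      by (simp add: o_def)
    from bounded_linear.has_derivative[OF bounded_linear_cnj this]
    have "(hardy_conj f has_derivative (\<lambda>h. \<Sum>j\<in>UNIV. (?c a) $ j * h $ j)) (at z)"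
      by (simp add: hardy_conj_def[abs_def])
    then show "\<exists>a. (hardy_conj f has_derivative (\<lambda>h. \<Sum>j\<in>UNIV. a $ j * h $ j)) (at z)"
      by blast
  qed
  then have J0: "polydisk_analytic0 (hardy_conj f)"
    using f0 c_pd by (auto simp: polydisk_analytic0_def hardy_conj_def)
  obtain A where ps: "power_series_on 1 A f"
    using f0 polydisk_analytic_power_series[of f] by (auto simp: polydisk_analytic0_def)
  have "torus_mean (hardy_conj f) r = torus_mean f r" if r: "0 < r" "r < 1" for r
    using torus_mean_Parseval[OF J0 hardy_conj_power_series[OF ps] r] torus_mean_Parseval[OF f0 ps r]
    by (simp del: power_mult) (rule has_sum_unique)
  then have "torus_mean (hardy_conj f) ` {0<..<1} = torus_mean f ` {0<..<1}"
    by (intro image_cong) auto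
  with f J0 show ?thesis by (simp add: hardy_space_iff)
qed

lemma hardy_conj_hardy_conj [simp]: "hardy_conj (hardy_conj f) = f"
  by (simp add: hardy_conj_def fun_eq_iff)

lemma hardy_conj_hardy_monomial [simp]: "hardy_conj (hardy_monomial b) = hardy_monomial b"
  by (auto simp: hardy_conj_def hardy_monomial_def fun_eq_iff polydisk_def monomial_def)

section \<open>Derivatives and products of power series\<close>

lemma monomial_update:
  "monomial a (\<chi> i. if i = j then w else z $ i) = w ^ a j * (\<Prod>i\<in>UNIV - {j}. z $ i ^ a i)"
proof -
  have "monomial a (\<chi> i. if i = j then w else z $ i) =
      w ^ a j * (\<Prod>i\<in>UNIV - {j}. (if i = j then w else z $ i) ^ a i)"
    unfolding monomial_def by (subst prod.remove[of _ j]) auto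
  also have "(\<Prod>i\<in>UNIV - {j}. (if i = j then w else z $ i) ^ a i) = (\<Prod>i\<in>UNIV - {j}. z $ i ^ a i)"
    by (intro prod.cong) auto
  finally show ?thesis .
qed

lemma power_series_on_partial_deriv:
  fixes f :: "complex^'n::finite \<Rightarrow> complex"
  assumes ps: "power_series_on 1 A f"
  shows "power_series_on 1 (\<lambda>a. of_nat (Suc (a j)) * A (a(j := Suc (a j)))) (partial_deriv j f)"
  unfolding power_series_on_def
proof (intro allI impI)
  fix z :: "complex^'n" assume z: "\<forall>i. cmod (z $ i) < 1"
  define Z where "Z w = (\<chi> i. if i = j then w else z $ i)" for w
  define R where "R a = (\<Prod>i\<in>UNIV - {j}. z $ i ^ a i)" for a :: "'n \<Rightarrow> nat"
  \<comment> \<open>\<open>d\<close> is half the distance from \<open>z $ j\<close> to the unit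
    circle. The disk of radius \<open>d\<close> about \<open>z $ j\<close> lies in
    \<open>cball 0 s\<close> with \<open>s < 1\<close>, so the terms at the real point
    \<open>s\<close> are the majorants for the M-test.\<close>
  define d where "d = (1 - cmod (z $ j)) / 2"
  define s where "s = cmod (z $ j) + d"
  have d: "d > 0" and s: "0 \<le> s" "s < 1" using z[rule_format, of j] by (auto simp: d_def s_def field_simps)
  have mZ: "monomial a (Z w) = w ^ a j * R a" for a w
    by (simp add: Z_def R_def monomial_update)
  have Zz: "Z (z $ j) = z" by (simp add: Z_def vec_eq_iff)
  have w: "cmod w \<le> s" if "w \<in> cball (z $ j) d" for w
    using that norm_triangle_ineq2[of w "z $ j"] by (simp add: s_def dist_norm norm_minus_commute)
  let ?I = "finite_subsets_at_top (UNIV :: ('n \<Rightarrow> nat) set)"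
  let ?D = "\<lambda>a w. A a * (of_nat (a j) * w ^ (a j - 1) * R a)"
  \<comment> \<open>A \<open>has_sum\<close> is a limit along finite subsets, so Weierstrass' theorem on locally uniform limits of
    holomorphic functions differentiates it term by term.\<close>
  have ul: "uniform_limit (cball (z $ j) d) (\<lambda>X w. \<Sum>a\<in>X. A a * monomial a (Z w)) (\<lambda>w. f (Z w)) ?I"
  proof (rule Weierstrass_m_test_general'[where M = "\<lambda>a. cmod (A a * monomial a (Z (of_real s)))"])
    show "norm (A a * monomial a (Z w)) \<le> cmod (A a * monomial a (Z (of_real s)))"
      if "w \<in> cball (z $ j) d" for a w
      using w[OF that] s by (auto simp: mZ norm_mult norm_power intro!: mult_left_mono mult_right_mono power_mono)
    show "((\<lambda>a. A a * monomial a (Z w)) has_sum f (Z w)) UNIV" if "w \<in> cball (z $ j) d" for w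
      using ps w[OF that] s z by (auto simp: power_series_on_def Z_def)
    show "(\<lambda>a. cmod (A a * monomial a (Z (of_real s)))) summable_on UNIV"
      by (rule power_series_on_abs_summable[OF ps]) (use s z in \<open>auto simp: Z_def\<close>)
  qed
  have diff: "((\<lambda>w. \<Sum>a\<in>X. A a * monomial a (Z w)) has_field_derivative (\<Sum>a\<in>X. ?D a w)) (at w)" for X w
    unfolding mZ by (auto intro!: derivative_eq_intros simp: mult_ac)
  have "\<forall>\<^sub>F X in ?I. continuous_on (cball (z $ j) d) (\<lambda>w. \<Sum>a\<in>X. A a * monomial a (Z w)) \<and>
      (\<forall>w\<in>ball (z $ j) d. ((\<lambda>w. \<Sum>a\<in>X. A a * monomial a (Z w)) has_field_derivative (\<Sum>a\<in>X. ?D a w)) (at w))"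
    by (intro always_eventually allI conjI ballI diff) (auto simp: mZ intro!: continuous_intros)
  from has_complex_derivative_uniform_limit[OF this ul _ d]
  obtain g' where g': "\<And>w. w \<in> ball (z $ j) d \<Longrightarrow>
      ((\<lambda>w. f (Z w)) has_field_derivative g' w) (at w) \<and> ((\<lambda>X. \<Sum>a\<in>X. ?D a w) \<longlongrightarrow> g' w) ?I"
    by auto
  have "g' (z $ j) = partial_deriv j f z"
    using g'[of "z $ j"] d by (auto simp: partial_deriv_def Z_def DERIV_imp_deriv)
  with g'[of "z $ j"] d have sum: "((\<lambda>a. ?D a (z $ j)) has_sum partial_deriv j f z) UNIV"
    by (simp add: has_sum_def)
  \<comment> \<open>The shift \<open>?h\<close> misses the indices with \<open>a j = 0\<close>;
    their terms vanish through the factor \<open>of_nat (a j)\<close>, whatever the truncated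
    exponent \<open>a j - 1\<close> is.\<close>
  let ?h = "\<lambda>a. a(j := Suc (a j))"
  have inj: "inj ?h"
    by (rule injI) (metis fun_upd_idem_iff fun_upd_same fun_upd_upd nat.inject)
  have "a \<in> range ?h" if "a j \<noteq> 0" for a
    using that by (intro image_eqI[of _ _ "a(j := a j - 1)"]) (auto simp: fun_eq_iff)
  then have "((\<lambda>a. ?D a (z $ j)) has_sum partial_deriv j f z) (range ?h)"
    by (intro has_sum_cong_neutral[THEN iffD1, OF _ _ _ sum]) auto
  then have "((\<lambda>a. ?D (?h a) (z $ j)) has_sum partial_deriv j f z) UNIV"
    using has_sum_reindex[OF inj, of "\<lambda>a. ?D a (z $ j)"] by (simp add: o_def)
  moreover have "R (?h a) = R a" for a
    unfolding R_def by (intro prod.cong) auto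
  moreover have "monomial a z = z $ j ^ a j * R a" for a
    using mZ[of a "z $ j"] Zz by simp
  ultimately show "((\<lambda>a. of_nat (Suc (a j)) * A (a(j := Suc (a j))) * monomial a z) has_sum partial_deriv j f z) UNIV"
    by (simp add: mult_ac)
qed

lemma power_series_on_partial_deriv_funpow:
  assumes "power_series_on 1 A f"
  shows "power_series_on 1 (\<lambda>a. fact (a j + n) / fact (a j) * A (a(j := a j + n))) ((partial_deriv j ^^ n) f)"
proof (induction n)
  case 0
  then show ?case using assms by simp
next
  case (Suc n)
  have "of_nat (Suc (a j)) * (fact (Suc (a j) + n) / fact (Suc (a j)) * x) =
      fact (a j + Suc n) / fact (a j) * (x :: complex)" for a x
  proof -
    have "of_nat (Suc (a j)) \<noteq> (0 :: complex)" by (simp only: of_nat_eq_0_iff)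
    then show ?thesis
      by (simp only: fact_Suc[of "a j"] add_Suc add_Suc_right) (simp del: of_nat_Suc fact_Suc)
  qed
  note step = this
  have upd: "(a(j := Suc (a j)))(j := Suc (a j) + n) = a(j := a j + Suc n)" for a
    by simp
  show ?case
    using power_series_on_partial_deriv[OF Suc.IH, of j]
    by (simp only: fun_upd_same upd step funpow.simps o_apply)
qed

text \<open>The enumeration in \<open>mixed_deriv\<close> is an unspecified choice, so the formula
  is proved for every distinct list of coordinates. Distinctness ensures that each coordinate is
  shifted only once.\<close>

lemma power_series_on_mixed_deriv:
  fixes f :: "complex^'n::finite \<Rightarrow> complex"
  assumes ps: "power_series_on 1 A f"
  shows "power_series_on 1 (\<lambda>a. (\<Prod>j\<in>UNIV. fact (a j + k j) / fact (a j)) * A (\<lambda>j. a j + k j)) (mixed_deriv k f)"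
proof -
  have list: "power_series_on 1 (\<lambda>a. (\<Prod>j\<in>set js. fact (a j + k j) / fact (a j)) *
      A (\<lambda>i. if i \<in> set js then a i + k i else a i)) (foldr (\<lambda>j. partial_deriv j ^^ k j) js f)"
    if "distinct js" for js
    using that
  proof (induction js)
    case Nil
    then show ?case using ps by simp
  next
    case (Cons j js)
    let ?B = "\<lambda>a. (\<Prod>j\<in>set js. fact (a j + k j) / fact (a j)) *
      A (\<lambda>i. if i \<in> set js then a i + k i else a i)"
    have "power_series_on 1 (\<lambda>a. fact (a j + k j) / fact (a j) * ?B (a(j := a j + k j)))
        (foldr (\<lambda>j. partial_deriv j ^^ k j) (j # js) f)"
      using power_series_on_partial_deriv_funpow[OF Cons.IH, of j "k j"] Cons.prems by simp
    also have "(\<lambda>a. fact (a j + k j) / fact (a j) * ?B (a(j := a j + k j))) =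
        (\<lambda>a. (\<Prod>j\<in>set (j # js). fact (a j + k j) / fact (a j)) *
          A (\<lambda>i. if i \<in> set (j # js) then a i + k i else a i))"
    proof
      fix a
      have "(\<Prod>i\<in>set js. fact ((a(j := a j + k j)) i + k i) / fact ((a(j := a j + k j)) i)) =
          (\<Prod>i\<in>set js. fact (a i + k i) / (fact (a i) :: complex))"
        using Cons.prems by (intro prod.cong) auto
      moreover have "(\<lambda>i. if i \<in> set js then (a(j := a j + k j)) i + k i else (a(j := a j + k j)) i) =
          (\<lambda>i. if i \<in> set (j # js) then a i + k i else a i)"
        using Cons.prems by auto
      ultimately show "fact (a j + k j) / fact (a j) * ?B (a(j := a j + k j)) =
          (\<Prod>j\<in>set (j # js). fact (a j + k j) / fact (a j)) *
            A (\<lambda>i. if i \<in> set (j # js) then a i + k i else a i)"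
        using Cons.prems by simp
    qed
    finally show ?case .
  qed
  define js where "js = (SOME js :: 'n list. distinct js \<and> set js = UNIV)"
  have "distinct js \<and> set js = UNIV"
    unfolding js_def by (rule someI_ex) (metis finite_class.finite_UNIV finite_distinct_list)
  with list[of js] show ?thesis
    unfolding mixed_deriv_def js_def[symmetric] by simp
qed

lemma mixed_deriv_hardy_monomial:
  fixes z :: "complex^'n::finite"
  assumes z: "z \<in> polydisk"
  shows "mixed_deriv k (hardy_monomial a) z =
    (if \<forall>j. k j \<le> a j then (\<Prod>j\<in>UNIV. fact (a j) / fact (a j - k j)) * monomial (\<lambda>j. a j - k j) z else 0)"
proof -
  let ?c = "\<lambda>b. \<Prod>j\<in>UNIV. fact (b j + k j) / (fact (b j) :: complex)"
  have sum: "((\<lambda>b. ?c b * (if (\<lambda>j. b j + k j) = a then 1 else 0) * monomial b z) has_sum mixed_deriv k (hardy_monomial a) z) UNIV"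
    using power_series_on_mixed_deriv[OF power_series_on_hardy_monomial[of a], of k] z
    by (simp add: power_series_on_def polydisk_def)
  show ?thesis
  proof (cases "\<forall>j. k j \<le> a j")
    case True
    then have "(\<lambda>j. b j + k j) = a \<longleftrightarrow> b = (\<lambda>j. a j - k j)" for b
      by (metis (no_types, lifting) add_diff_cancel_right' ext le_add_diff_inverse2)
    then have "(\<lambda>b. ?c b * (if (\<lambda>j. b j + k j) = a then 1 else 0) * monomial b z) =
        (\<lambda>b. if b = (\<lambda>j. a j - k j) then ?c b * monomial b z else 0)"
      by (intro ext) simp
    with sum have "((\<lambda>b. if b = (\<lambda>j. a j - k j) then ?c b * monomial b z else 0) has_sum mixed_deriv k (hardy_monomial a) z) UNIV"
      by simp
    from has_sum_unique[OF this has_sum_delta[of "\<lambda>j. a j - k j" "\<lambda>b. ?c b * monomial b z"]]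
    show ?thesis using True by simp
  next
    case False
    then have "(\<lambda>j. b j + k j) \<noteq> a" for b by auto
    with sum have "((\<lambda>b :: 'n \<Rightarrow> nat. 0) has_sum mixed_deriv k (hardy_monomial a) z) UNIV" by simp
    from has_sum_unique[OF this has_sum_0_simp] show ?thesis by (simp only: False if_False)
  qed
qed

text \<open>Convergence of the Taylor series at a radius \<open>r\<close> beyond \<open>|w|\<close>
  makes it absolutely convergent at \<open>w\<close>, which upgrades \<open>sums\<close> to
  \<open>has_sum\<close>.\<close>

lemma holomorphic_has_sum_fps:
  assumes h: "h holomorphic_on ball 0 1" and w: "cmod w < 1"
  shows "((\<lambda>m. fps_nth (fps_expansion h 0) m * w ^ m) has_sum h w) UNIV"
proof -
  have s: "(\<lambda>m. fps_nth (fps_expansion h 0) m * x ^ m) sums h x" if "cmod x < 1" for x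
    using holomorphic_power_series[OF h, of x] that by (simp add: fps_expansion_def)
  obtain r where r: "cmod w < r" "r < 1" using w dense by blast
  then have r0: "0 \<le> r" using norm_ge_zero[of w] by linarith
  have "summable (\<lambda>m. fps_nth (fps_expansion h 0) m * of_real r ^ m)"
    using s[of "of_real r"] r r0 by (simp add: sums_summable)
  then have "summable (\<lambda>m. norm (fps_nth (fps_expansion h 0) m * w ^ m))"
    by (rule powser_insidea) (use r r0 in auto)
  with s[OF w] show ?thesis by (intro norm_summable_imp_has_sum)
qed

lemma power_series_on_prod:
  fixes h :: "'n::finite \<Rightarrow> complex \<Rightarrow> complex"
  assumes "\<And>j. h j holomorphic_on ball 0 1"
  shows "power_series_on 1 (\<lambda>a. \<Prod>j\<in>UNIV. fps_nth (fps_expansion (h j) 0) (a j)) (\<lambda>z. \<Prod>j\<in>UNIV. h j (z $ j))"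
  unfolding power_series_on_def
proof (intro allI impI)
  fix z :: "complex^'n" assume "\<forall>j. cmod (z $ j) < 1"
  then have "((\<lambda>a. \<Prod>j\<in>UNIV. fps_nth (fps_expansion (h j) 0) (a j) * z $ j ^ a j) has_sum (\<Prod>j\<in>UNIV. h j (z $ j))) UNIV"
    using assms by (intro has_sum_prod_fun holomorphic_has_sum_fps) auto
  then show "((\<lambda>a. (\<Prod>j\<in>UNIV. fps_nth (fps_expansion (h j) 0) (a j)) * monomial a z) has_sum (\<Prod>j\<in>UNIV. h j (z $ j))) UNIV"
    by (simp add: monomial_def prod.distrib)
qed

lemma fps_expansion_power_mult:
  assumes "h holomorphic_on ball 0 1"
  shows "fps_expansion (\<lambda>w. w ^ m * h w ^ l) 0 = fps_X ^ m * fps_expansion h 0 ^ l"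
proof -
  have "h has_fps_expansion fps_expansion h 0"
    using assms by (intro has_fps_expansion_fps_expansion[of "ball 0 1"]) auto
  then have "(\<lambda>w. w ^ m * h w ^ l) has_fps_expansion fps_X ^ m * fps_expansion h 0 ^ l"
    by (intro fps_expansion_intros)
  then show ?thesis by (rule fps_expansion_eqI)
qed

section \<open>Symmetric weighted composition-differentiation operators\<close>

lemma hardy_space_power_series:
  assumes "f \<in> hardy_space"
  obtains A where "power_series_on 1 A f"
  using assms polydisk_analytic_power_series[of f] by (auto simp: hardy_space_def)

lemma hardy_space_eqI:
  assumes "f \<in> hardy_space" "g \<in> hardy_space" "power_series_on 1 A f" "power_series_on 1 A g"
  shows "f = g"
proof
  fix z
  show "f z = g z"
  proof (cases "z \<in> polydisk")
    case True
    then show ?thesis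
      using assms(3,4) by (auto simp: power_series_on_def polydisk_def intro: has_sum_unique)
  next
    case False
    then show ?thesis using assms(1,2) by (auto simp: hardy_space_def)
  qed
qed

lemma power_series_on_cmult:
  assumes "power_series_on R A f"
  shows "power_series_on R (\<lambda>a. c * A a) (\<lambda>z. c * f z)"
  using assms unfolding power_series_on_def by (auto simp: mult.assoc intro!: has_sum_cmult_right)

lemma monomial_add: "monomial (\<lambda>j. a j + b j) z = monomial a z * monomial b z"
  by (simp add: monomial_def power_add prod.distrib)

text \<open>The adjoint turns the left side into the conjugate of the \<open>a\<close>-th
  coefficient of \<open>S z^b\<close>. That is the \<open>a\<close>-th coefficient of
  \<open>J S z^b = J S J z^b = T z^b\<close>.\<close>

lemma hardy_inner_symmetric:
  assumes adj: "is_hardy_adjoint T S" and sym: "\<forall>f\<in>hardy_space. T f = hardy_conj (S (hardy_conj f))"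
  shows "hardy_inner (T (hardy_monomial a)) (hardy_monomial b) =
         hardy_inner (T (hardy_monomial b)) (hardy_monomial a)"
proof -
  note hm = hardy_monomial_in_hardy_space
  have Sb: "S (hardy_monomial b) \<in> hardy_space"
    using adj hm by (auto simp: is_hardy_adjoint_def)
  then obtain B where B: "power_series_on 1 B (S (hardy_monomial b))"
    by (rule hardy_space_power_series)
  have "hardy_inner (T (hardy_monomial a)) (hardy_monomial b) = hardy_inner (hardy_monomial a) (S (hardy_monomial b))"
    using adj hm by (auto simp: is_hardy_adjoint_def)
  also have "\<dots> = cnj (B a)"
    by (subst hardy_inner_commute) (simp add: hardy_inner_monomial_right[OF Sb B])
  also have "\<dots> = hardy_inner (hardy_conj (S (hardy_monomial b))) (hardy_monomial a)"
    by (simp add: hardy_inner_monomial_right[OF hardy_conj_in_hardy_space[OF Sb] hardy_conj_power_series[OF B]])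
  also have "hardy_conj (S (hardy_monomial b)) = T (hardy_monomial b)"
    using sym[rule_format, OF hm] by simp
  finally show ?thesis .
qed

text \<open>Expanding only \<open>u\<close> avoids Cauchy products: each term \<open>z\<^sup>a \<Prod>\<^sub>j h\<^sub>j(z\<^sub>j)\<close> with \<open>k \<le> a\<close> splits into
  functions of one variable, and the \<open>i\<close>-th one has order greater than \<open>k\<^sub>i\<close> at \<open>0\<close>.\<close>

lemma power_series_on_mult_coeff_zero:
  fixes u :: "complex^'n::finite \<Rightarrow> complex"
  assumes u: "power_series_on 1 U u" and supp: "\<And>a. \<not> (\<forall>j. k j \<le> a j) \<Longrightarrow> U a = 0"
    and h: "\<And>j. h j holomorphic_on ball 0 1" and hb: "\<And>j w. cmod w < 1 \<Longrightarrow> cmod (h j w) \<le> 1"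
    and hi: "h i 0 = 0"
    and B: "power_series_on 1 B (\<lambda>z. u z * (\<Prod>j\<in>UNIV. h j (z $ j)))"
  shows "B k = 0"
proof -
  define r :: real where "r = 1/2"
  have r: "0 < r" "r < 1" by (auto simp: r_def)
  define G where "G z = (\<Prod>j\<in>UNIV. h j (z $ j))" for z :: "complex^'n"
  let ?t = "\<lambda>\<theta>. r *\<^sub>R torus_point \<theta> :: complex^'n"
  have G: "power_series_on 1 (\<lambda>b. \<Prod>j\<in>UNIV. fps_nth (fps_X ^ a j * fps_expansion (h j) 0) (b j))
      (\<lambda>z. monomial a z * G z)" for a
  proof -
    have "(\<lambda>w. w ^ a j * h j w) holomorphic_on ball 0 1" for j
      by (intro holomorphic_intros h)
    from power_series_on_prod[of "\<lambda>j w. w ^ a j * h j w", OF this]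
    show ?thesis
      using fps_expansion_power_mult[OF h, of _ _ 1] by (simp add: G_def monomial_def prod.distrib)
  qed
  note F = power_series_on_fourier[OF G r]
  \<comment> \<open>With \<open>|G| \<le> 1\<close> the absolutely summable series of
    \<open>u\<close> at radius \<open>r\<close> dominates the terms multiplied by
    \<open>G\<close>.\<close>
  have Gb: "cmod (G (?t \<theta>)) \<le> 1" for \<theta>
    unfolding G_def prod_norm[symmetric] using r by (intro prod_le_1) (auto intro!: hb)
  have summ: "(\<lambda>a. cmod (U a) * r ^ total_degree a) summable_on UNIV"
    using power_series_on_abs_summable[OF u, of "?t (\<lambda>_. 0)"] r
    by (simp add: monomial_scaleR norm_mult norm_power)
  let ?g = "\<lambda>a \<theta>. U a * (monomial a (?t \<theta>) * G (?t \<theta>) * cnj (monomial k (torus_point \<theta>)))"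
  have "((\<lambda>a. \<integral>\<theta>. ?g a \<theta> \<partial>angles) has_sum fourier_coeff (\<lambda>z. u z * G z) r k) UNIV"
    unfolding fourier_coeff_def
  proof (rule angles.has_sum_integral(2)[OF _ _ summ])
    show "?g a \<in> borel_measurable angles" for a
      using F(1)[of a] by measurable
    show "norm (?g a \<theta>) \<le> cmod (U a) * r ^ total_degree a" for a \<theta>
      using Gb[of \<theta>] r
      by (auto simp: monomial_scaleR norm_mult norm_power intro!: mult_left_mono mult_left_le)
    show "((\<lambda>a. ?g a \<theta>) has_sum u (?t \<theta>) * G (?t \<theta>) * cnj (monomial k (torus_point \<theta>))) UNIV" for \<theta>
    proof -
      have "((\<lambda>a. U a * monomial a (?t \<theta>)) has_sum u (?t \<theta>)) UNIV"
        using u r by (simp add: power_series_on_def)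
      from has_sum_cmult_left[OF this, of "G (?t \<theta>) * cnj (monomial k (torus_point \<theta>))"]
      show ?thesis by (simp add: mult_ac)
    qed
  qed
  moreover have "(\<integral>\<theta>. ?g a \<theta> \<partial>angles) = 0" for a
  proof (cases "\<forall>j. k j \<le> a j")
    case True
    \<comment> \<open>Given \<open>k i \<le> a i\<close>, the coefficient is
      \<open>h i 0 = 0\<close> when \<open>a i = k i\<close>, and it is zero through the factor
      \<open>fps_X ^ a i\<close> when \<open>a i\<close> is larger.\<close>
    have "fps_nth (fps_X ^ a i * fps_expansion (h i) 0) (k i) = 0"
      using hi True by (simp add: fps_X_power_mult_nth fps_expansion_def)
    then have "(\<Prod>j\<in>UNIV. fps_nth (fps_X ^ a j * fps_expansion (h j) 0) (k j)) = 0"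
      by (intro prod_zero) auto
    then have "fourier_coeff (\<lambda>z. monomial a z * G z) r k = 0"
      unfolding F(2) by simp
    then show ?thesis unfolding fourier_coeff_def
      by (simp only: Bochner_Integration.integral_mult_right_zero) simp
  qed (simp add: supp)
  ultimately have "((\<lambda>a :: 'n \<Rightarrow> nat. 0) has_sum fourier_coeff (\<lambda>z. u z * G z) r k) UNIV"
    by (simp only:)
  from has_sum_unique[OF this has_sum_0_simp] have "fourier_coeff (\<lambda>z. u z * G z) r k = 0" .
  with power_series_on_fourier(2)[OF B r, of k] r show ?thesis
    by (simp add: G_def)
qed

section \<open>The form of \<open>u\<close> and \<open>v\<close> forced by symmetry\<close>

lemma weighted_comp_diff_hardy_monomial:
  assumes "\<And>j. v j \<in> ball 0 1 \<rightarrow> ball 0 1" "z \<in> polydisk"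
  shows "weighted_comp_diff u v k (hardy_monomial a) z =
    (if \<forall>j. k j \<le> a j then (\<Prod>j\<in>UNIV. fact (a j) / fact (a j - k j)) * u z * (\<Prod>j\<in>UNIV. v j (z $ j) ^ (a j - k j)) else 0)"
proof -
  have "v j (z $ j) \<in> ball 0 1" for j
    using assms by (intro funcset_mem[OF assms(1)]) (auto simp: polydisk_def)
  then have "(\<chi> j. v j (z $ j)) \<in> polydisk" by (simp add: polydisk_def)
  then show ?thesis
    using assms(2) by (simp add: weighted_comp_diff_def mixed_deriv_hardy_monomial monomial_def)
qed

text \<open>On \<open>z^k\<close> all powers of \<open>v\<close> have exponent \<open>0\<close>, so
  \<open>T\<close> sends it to \<open>C k * u\<close>. The coefficients of \<open>u\<close> are thus
  matrix entries up to the nonzero factor \<open>C k\<close>, and symmetry lets them be computed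
  from \<open>T z^b\<close> instead.\<close>

lemma weight_eq_monomial:
  fixes u :: "complex^'n::finite \<Rightarrow> complex" and v :: "'n \<Rightarrow> complex \<Rightarrow> complex" and k :: "'n \<Rightarrow> nat"
  defines "T \<equiv> weighted_comp_diff u v k"
  assumes u: "polydisk_analytic u"
    and v: "\<And>j. v j holomorphic_on ball 0 1" "\<And>j. v j \<in> ball 0 1 \<rightarrow> ball 0 1" "\<And>j. v j 0 = 0"
    and T: "T \<in> hardy_space \<rightarrow> hardy_space"
    and sym: "\<And>a b. hardy_inner (T (hardy_monomial a)) (hardy_monomial b) =
                       hardy_inner (T (hardy_monomial b)) (hardy_monomial a)"
  obtains c where "\<And>z. z \<in> polydisk \<Longrightarrow> u z = c * monomial k z"
proof -
  obtain U where U: "power_series_on 1 U u"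
    using u by (rule polydisk_analytic_power_series)
  define C where "C a = (\<Prod>j\<in>UNIV. fact (a j) / (fact (a j - k j) :: complex))" for a
  have C: "C a \<noteq> 0" for a by (simp add: C_def)
  have Tm: "T (hardy_monomial a) z =
      (if \<forall>j. k j \<le> a j then C a * u z * (\<Prod>j\<in>UNIV. v j (z $ j) ^ (a j - k j)) else 0)"
    if "z \<in> polydisk" for a z
    unfolding T_def C_def by (rule weighted_comp_diff_hardy_monomial[OF v(2) that])
  have TH: "T (hardy_monomial a) \<in> hardy_space" for a
    using T hardy_monomial_in_hardy_space by (rule funcset_mem)
  have "power_series_on 1 (\<lambda>b. C k * U b) (T (hardy_monomial k))"
    using power_series_on_cmult[OF U, of "C k"]
    by (subst power_series_on_cong[of _ "\<lambda>z. C k * u z"]) (auto simp: Tm)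
  then have I: "hardy_inner (T (hardy_monomial k)) (hardy_monomial b) = C k * U b" for b
    by (rule hardy_inner_monomial_right[OF TH])
  \<comment> \<open>This comes before \<open>zero\<close>: the vanishing of the \<open>k\<close>-th
    coefficient of \<open>u v^(b-k)\<close> relies on \<open>u\<close> having only terms with index
    at least \<open>k\<close>.\<close>
  have supp: "U b = 0" if "\<not> (\<forall>j. k j \<le> b j)" for b
  proof -
    have "power_series_on 1 (\<lambda>_. 0) (T (hardy_monomial b))"
      using that by (subst power_series_on_cong[of _ "\<lambda>z. 0"]) (auto simp: Tm power_series_on_def)
    from hardy_inner_monomial_right[OF TH this, of k] have "C k * U b = 0"
      using sym[of b k] by (simp add: I)
    with C show ?thesis by simp
  qed
  have zero: "U b = 0" if "b \<noteq> k" for b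
  proof (cases "\<forall>j. k j \<le> b j")
    case True
    \<comment> \<open>In this coordinate the exponent \<open>b i - k i\<close> is positive, so
      \<open>v i ^ (b i - k i)\<close> vanishes at \<open>0\<close>. In others it may be zero,
      giving the constant \<open>1\<close>.\<close>
    with that obtain i where i: "k i < b i" by (metis ext le_neq_implies_less)
    obtain B where B: "power_series_on 1 B (T (hardy_monomial b))"
      using TH by (rule hardy_space_power_series)
    have "power_series_on 1 B (\<lambda>z. (C b * u z) * (\<Prod>j\<in>UNIV. v j (z $ j) ^ (b j - k j)))"
      using B True by (subst power_series_on_cong[of _ "T (hardy_monomial b)"]) (auto simp: Tm)
    then have "B k = 0"
    proof (rule power_series_on_mult_coeff_zero[where i = i, rotated -1])
      show "power_series_on 1 (\<lambda>a. C b * U a) (\<lambda>z. C b * u z)"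
        by (rule power_series_on_cmult[OF U])
      show "(\<lambda>w. v j w ^ (b j - k j)) holomorphic_on ball 0 1" for j
        by (intro holomorphic_intros v)
      show "cmod (v j w ^ (b j - k j)) \<le> 1" if "cmod w < 1" for j w
        using funcset_mem[OF v(2), of w j] that by (simp add: norm_power power_le_one)
    qed (use i v supp in auto)
    then have "C k * U b = 0"
      using sym[of b k] hardy_inner_monomial_right[OF TH B, of k] by (simp add: I)
    with C show ?thesis by simp
  qed (rule supp)
  show thesis
  proof
    fix z :: "complex^'n" assume "z \<in> polydisk"
    then have "((\<lambda>a. U a * monomial a z) has_sum u z) UNIV"
      using U by (simp add: power_series_on_def polydisk_def)
    also have "(\<lambda>a. U a * monomial a z) = (\<lambda>a. if a = k then U a * monomial a z else 0)"
      using zero by (intro ext) simp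
    finally show "u z = U k * monomial k z"
      by (rule has_sum_unique) (rule has_sum_delta[of k "\<lambda>a. U a * monomial a z"])
  qed
qed

text \<open>Along the indices \<open>e m = k + m e_j\<close> only \<open>v j\<close> is raised to a
  positive power, so the entry for \<open>e m\<close>, \<open>e l\<close> is
  \<open>C (e m) * c\<close> times the \<open>l\<close>-th coefficient of \<open>V ^ m\<close>.
  Symmetry then relates \<open>V ^ m\<close> at \<open>1\<close> to \<open>V\<close> at
  \<open>m\<close>.\<close>

lemma self_map_linear:
  fixes u :: "complex^'n::finite \<Rightarrow> complex" and v :: "'n \<Rightarrow> complex \<Rightarrow> complex" and k :: "'n \<Rightarrow> nat"
  defines "T \<equiv> weighted_comp_diff u v k"
  assumes u: "\<And>z. z \<in> polydisk \<Longrightarrow> u z = c * monomial k z" and c: "c \<noteq> 0"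
    and v: "\<And>j. v j holomorphic_on ball 0 1" "\<And>j. v j \<in> ball 0 1 \<rightarrow> ball 0 1" "\<And>j. v j 0 = 0"
    and T: "T \<in> hardy_space \<rightarrow> hardy_space"
    and sym: "\<And>a b. hardy_inner (T (hardy_monomial a)) (hardy_monomial b) =
                       hardy_inner (T (hardy_monomial b)) (hardy_monomial a)"
  obtains \<alpha> where "\<And>w. cmod w < 1 \<Longrightarrow> v j w = \<alpha> * w"
proof -
  define V where "V = fps_expansion (v j) 0"
  define e where "e m = k(j := k j + m)" for m
  define C where "C a = (\<Prod>j\<in>UNIV. fact (a j) / (fact (a j - k j) :: complex))" for a
  have C: "C a \<noteq> 0" for a by (simp add: C_def)
  have V0: "fps_nth V 0 = 0" using v(3)[of j] by (simp add: V_def fps_expansion_def)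
  have I: "hardy_inner (T (hardy_monomial (e m))) (hardy_monomial (e l)) = C (e m) * c * fps_nth (V ^ m) l" for m l
  proof -
    \<comment> \<open>Constants \<open>1\<close> in the other coordinates put \<open>v j ^ m\<close>
      in the shape of a full product of one-variable functions.\<close>
    define g where "g i = (if i = j then v j else (\<lambda>_. 1))" for i
    have g: "g i holomorphic_on ball 0 1" for i using v by (simp add: g_def)
    have "power_series_on 1 (\<lambda>b. \<Prod>i\<in>UNIV. fps_nth (fps_expansion (\<lambda>w. w ^ k i * g i w ^ m) 0) (b i))
        (\<lambda>z. \<Prod>i\<in>UNIV. z $ i ^ k i * g i (z $ i) ^ m)"
      by (rule power_series_on_prod) (intro holomorphic_intros g)
    from power_series_on_cmult[OF this, of "C (e m) * c"]
    have "power_series_on 1 (\<lambda>b. C (e m) * c * (\<Prod>i\<in>UNIV. fps_nth (fps_X ^ k i * fps_expansion (g i) 0 ^ m) (b i)))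
        (\<lambda>z. C (e m) * c * (\<Prod>i\<in>UNIV. z $ i ^ k i * g i (z $ i) ^ m))"
      by (simp only: fps_expansion_power_mult[OF g])
    moreover have "T (hardy_monomial (e m)) z = C (e m) * c * (\<Prod>i\<in>UNIV. z $ i ^ k i * g i (z $ i) ^ m)"
      if "z \<in> polydisk" for z
    proof -
      have "(\<Prod>i\<in>UNIV. v i (z $ i) ^ (e m i - k i)) = (\<Prod>i\<in>UNIV. g i (z $ i) ^ m)"
        by (intro prod.cong) (auto simp: e_def g_def)
      moreover have "\<forall>i. k i \<le> e m i" by (simp add: e_def)
      ultimately show ?thesis
        unfolding T_def weighted_comp_diff_hardy_monomial[OF v(2) that]
        by (simp add: C_def u[OF that] monomial_def prod.distrib)
    qed
    ultimately have "power_series_on 1 (\<lambda>b. C (e m) * c * (\<Prod>i\<in>UNIV. fps_nth (fps_X ^ k i * fps_expansion (g i) 0 ^ m) (b i)))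
        (T (hardy_monomial (e m)))"
      by (subst power_series_on_cong) auto
    from hardy_inner_monomial_right[OF _ this, of "e l"]
    have "hardy_inner (T (hardy_monomial (e m))) (hardy_monomial (e l)) =
        C (e m) * c * (\<Prod>i\<in>UNIV. fps_nth (fps_X ^ k i * fps_expansion (g i) 0 ^ m) (e l i))"
      using funcset_mem[OF T hardy_monomial_in_hardy_space] by blast
    also have "(\<Prod>i\<in>UNIV. fps_nth (fps_X ^ k i * fps_expansion (g i) 0 ^ m) (e l i)) =
        (\<Prod>i\<in>UNIV. if i = j then fps_nth (V ^ m) l else 1)"
    proof (rule prod.cong[OF refl])
      fix i
      have "fps_expansion (\<lambda>_. 1) 0 = (1 :: complex fps)"
        by (intro fps_expansion_eqI has_fps_expansion_1)
      then show "fps_nth (fps_X ^ k i * fps_expansion (g i) 0 ^ m) (e l i) = (if i = j then fps_nth (V ^ m) l else 1)"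
        by (simp add: g_def e_def V_def fps_X_power_mult_nth)
    qed
    finally show ?thesis by simp
  qed
  have zero: "fps_nth V m = 0" if "m \<noteq> 1" for m
  proof (cases "m = 0")
    case False
    \<comment> \<open>Here \<open>m \<ge> 2\<close>, and \<open>V ^ m\<close> has order at least
      \<open>m\<close> because \<open>V\<close> has no constant term.\<close>
    with that have "fps_nth (V ^ m) 1 = 0"
      using startsby_zero_power_prefix[OF V0, of m] by auto
    then have "C (e 1) * c * fps_nth (V ^ 1) m = 0"
      using sym[of "e 1" "e m"] unfolding I by simp
    then show ?thesis using C c by simp
  qed (use V0 in simp)
  show thesis
  proof
    fix w :: complex assume w: "cmod w < 1"
    have "((\<lambda>m. fps_nth V m * w ^ m) has_sum v j w) UNIV"
      unfolding V_def by (rule holomorphic_has_sum_fps[OF v(1) w])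
    also have "(\<lambda>m. fps_nth V m * w ^ m) = (\<lambda>m. if m = 1 then fps_nth V m * w ^ m else 0)"
      using zero by (intro ext) simp
    finally have "v j w = fps_nth V 1 * w ^ 1"
      by (rule has_sum_unique) (rule has_sum_delta[of 1 "\<lambda>m. fps_nth V m * w ^ m"])
    then show "v j w = fps_nth V 1 * w" by simp
  qed
qed

text \<open>Differentiation sends index \<open>b + k\<close> to \<open>b\<close>, the linear maps
  contribute \<open>\<alpha>^b\<close>, and the weight \<open>c z^k\<close> shifts back to
  \<open>b + k\<close>. Some \<open>\<alpha> j\<close> may be \<open>0\<close>; then
  \<open>0 ^ 0 = 1\<close> keeps exactly the indices with \<open>a j = k j\<close> in that
  coordinate.\<close>

lemma weighted_comp_diff_diagonal:
  fixes u :: "complex^'n::finite \<Rightarrow> complex"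
  assumes u: "\<And>z. z \<in> polydisk \<Longrightarrow> u z = c * monomial k z"
    and v: "\<And>j. v j \<in> ball 0 1 \<rightarrow> ball 0 1" and lin: "\<And>j w. cmod w < 1 \<Longrightarrow> v j w = \<alpha> j * w"
    and A: "power_series_on 1 A f"
  shows "power_series_on 1 (\<lambda>a. (if \<forall>j. k j \<le> a j
      then c * (\<Prod>j\<in>UNIV. fact (a j) / fact (a j - k j) * \<alpha> j ^ (a j - k j)) else 0) * A a)
      (weighted_comp_diff u v k f)"
  unfolding power_series_on_def
proof (intro allI impI)
  fix z :: "complex^'n" assume z: "\<forall>j. cmod (z $ j) < 1"
  then have zp: "z \<in> polydisk" by (simp add: polydisk_def)
  let ?V = "\<chi> j. v j (z $ j)"
  let ?L = "\<lambda>a. (if \<forall>j. k j \<le> a j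
      then c * (\<Prod>j\<in>UNIV. fact (a j) / fact (a j - k j) * \<alpha> j ^ (a j - k j)) else 0) * A a * monomial a z"
  let ?s = "\<lambda>b j. b j + k j"
  have "v j (z $ j) \<in> ball 0 1" for j
    using z by (intro funcset_mem[OF v]) auto
  then have "\<forall>j. cmod (?V $ j) < 1" by simp
  then have "((\<lambda>b. (\<Prod>j\<in>UNIV. fact (b j + k j) / fact (b j)) * A (?s b) * monomial b ?V) has_sum mixed_deriv k f ?V) UNIV"
    using power_series_on_mixed_deriv[OF A, of k] by (simp add: power_series_on_def)
  from has_sum_cmult_right[OF this, of "u z"]
  have "((\<lambda>b. u z * ((\<Prod>j\<in>UNIV. fact (b j + k j) / fact (b j)) * A (?s b) * monomial b ?V))
      has_sum weighted_comp_diff u v k f z) UNIV"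
    using zp by (simp add: weighted_comp_diff_def)
  moreover have "u z * ((\<Prod>j\<in>UNIV. fact (b j + k j) / fact (b j)) * A (?s b) * monomial b ?V) = ?L (?s b)" for b
  proof -
    have "monomial b ?V = (\<Prod>j\<in>UNIV. \<alpha> j ^ b j) * monomial b z"
      using lin z by (simp add: monomial_def power_mult_distrib prod.distrib)
    moreover have "?L (?s b) = c * ((\<Prod>j\<in>UNIV. fact (b j + k j) / fact (b j)) * (\<Prod>j\<in>UNIV. \<alpha> j ^ b j)) *
        A (?s b) * (monomial b z * monomial k z)"
      unfolding prod.distrib[symmetric] monomial_add[symmetric] by simp
    ultimately show ?thesis
      unfolding u[OF zp] by (simp only: mult_ac)
  qed
  ultimately have "((\<lambda>b. ?L (?s b)) has_sum weighted_comp_diff u v k f z) UNIV"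
    by simp
  moreover have "inj ?s" by (auto simp: inj_def fun_eq_iff)
  ultimately have "(?L has_sum weighted_comp_diff u v k f z) (range ?s)"
    by (subst has_sum_reindex) (auto simp: o_def)
  \<comment> \<open>Indices outside the range of the shift are those with some
    \<open>a j < k j\<close>, where \<open>?L\<close> is zero by definition, so the sum extends to
    all multi-indices.\<close>
  moreover have "a \<in> range ?s" if "\<forall>j. k j \<le> a j" for a
    using that by (intro image_eqI[of _ _ "\<lambda>j. a j - k j"]) auto
  ultimately show "(?L has_sum weighted_comp_diff u v k f z) UNIV"
    by (subst has_sum_cong_neutral[of "range ?s" _ _ ?L]) auto
qed

theorem theorem4p1:
  fixes u :: "complex^'n \<Rightarrow> complex"
    and v :: "'n \<Rightarrow> complex \<Rightarrow> complex"
    and k :: "'n \<Rightarrow> nat"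
  assumes u_analytic: "polydisk_analytic u"
    and u_nonzero: "\<exists>z\<in>polydisk. u z \<noteq> 0"
    and v_analytic: "\<And>j. v j holomorphic_on ball 0 1"
    and v_self_map: "\<And>j. v j \<in> ball 0 1 \<rightarrow> ball 0 1"
    and W_bounded: "hardy_bounded (weighted_comp_diff u v k)"
    and W_symmetric: "J_symmetric (weighted_comp_diff u v k)"
    and v_zero: "\<And>j. v j 0 = 0"
  shows "hardy_normal (weighted_comp_diff u v k)"
proof -
  let ?T = "weighted_comp_diff u v k"
  obtain S where adj: "is_hardy_adjoint ?T S"
    and sym: "\<forall>f\<in>hardy_space. ?T f = hardy_conj (S (hardy_conj f))"
    using W_symmetric by (auto simp: J_symmetric_def)
  have T: "?T \<in> hardy_space \<rightarrow> hardy_space" using W_bounded by (simp add: hardy_bounded_def)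
  have S: "S \<in> hardy_space \<rightarrow> hardy_space" using adj by (simp add: is_hardy_adjoint_def)
  note inner_sym = hardy_inner_symmetric[OF adj sym]
  obtain c where c: "\<And>z. z \<in> polydisk \<Longrightarrow> u z = c * monomial k z"
    using weight_eq_monomial[OF u_analytic v_analytic v_self_map v_zero T inner_sym] by blast
  have "c \<noteq> 0" using u_nonzero c by auto
  then have "\<exists>\<alpha>. \<forall>w. cmod w < 1 \<longrightarrow> v j w = \<alpha> * w" for j
    using self_map_linear[OF c _ v_analytic v_self_map v_zero T inner_sym, of j] by blast
  then obtain \<alpha> where \<alpha>: "\<And>j w. cmod w < 1 \<Longrightarrow> v j w = \<alpha> j * w" by metis
  define \<Lambda> where "\<Lambda> a = (if \<forall>j. k j \<le> a j
      then c * (\<Prod>j\<in>UNIV. fact (a j) / fact (a j - k j) * \<alpha> j ^ (a j - k j)) else 0)" for a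
  have Tps: "power_series_on 1 (\<lambda>a. \<Lambda> a * A a) (?T f)" if "power_series_on 1 A f" for A f
    unfolding \<Lambda>_def by (rule weighted_comp_diff_diagonal[OF c v_self_map \<alpha> that])
  \<comment> \<open>Applying the symmetry to \<open>hardy_conj f\<close> gives
    \<open>S = J T J\<close>. Conjugating coefficients before and after multiplication by
    \<open>\<Lambda> a\<close> amounts to multiplication by
    \<open>cnj (\<Lambda> a)\<close>.\<close>
  have Sps: "power_series_on 1 (\<lambda>a. cnj (\<Lambda> a) * A a) (S f)" if "f \<in> hardy_space" "power_series_on 1 A f" for A f
  proof -
    have "S f = hardy_conj (?T (hardy_conj f))"
      using sym[rule_format, OF hardy_conj_in_hardy_space[OF that(1)]] by simp
    then show ?thesis
      using hardy_conj_power_series[OF Tps[OF hardy_conj_power_series[OF that(2)]]] by simp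
  qed
  \<comment> \<open>Both orders multiply the \<open>a\<close>-th coefficient by
    \<open>|\<Lambda> a|^2\<close>, and an element of the Hardy space is determined by its
    coefficients.\<close>
  have "S (?T f) = ?T (S f)" if f: "f \<in> hardy_space" for f
  proof -
    obtain A where A: "power_series_on 1 A f" using f by (rule hardy_space_power_series)
    have "power_series_on 1 (\<lambda>a. cnj (\<Lambda> a) * (\<Lambda> a * A a)) (S (?T f))"
      by (intro Sps Tps A funcset_mem[OF T f])
    moreover have "power_series_on 1 (\<lambda>a. cnj (\<Lambda> a) * (\<Lambda> a * A a)) (?T (S f))"
      using Tps[OF Sps[OF f A]] by (simp add: mult.left_commute)
    ultimately show ?thesis
      by (intro hardy_space_eqI funcset_mem[OF S] funcset_mem[OF T] f)
  qed
  with W_bounded adj show ?thesis by (auto simp: hardy_normal_def)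
qed

end
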